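(* Let $p$ be a prime with $p\equiv1\pmod4$, and write $p=a^2+b^2$ with $a,b\in\mathbb Z$ and $a\equiv1\pmod4$. Then $$\sum_{k=0}^{\frac{p-1}4}\frac{\binom{4k}{2k}^2}{16^{2k}}\equiv\frac12+(-1)^{\frac{p-1}4}a-(-1)^{\frac{p-1}4}\frac p{4a}\pmod{p^2}.$$
   Context: Congruences are between rational numbers whose denominators are prime to $p$. *)

theory Defs
  imports Complex_Main "HOL-Computational_Algebra.Primes"
begin

definition rat_cong :: "rat \<Rightarrow> rat \<Rightarrow> int \<Rightarrow> bool" where
  "rat_cong x y m \<longleftrightarrow>
     (\<exists>u v :: int. v \<noteq> 0 \<and> coprime v m \<and> m dvd u \<and> x - y = of_int u / of_int v)"

end

theory Submission
  imports Defs "HOL-Number_Theory.Number_Theory" "HOL-Computational_Algebra.Formal_Power_Series"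
begin

text \<open>
  Put $p = 4m + 1$ and let $D = \sum_k \binom{2m}{k}\binom{2m+k}{k}$.
  For $k \le 2m$ one has $\binom{2k}{k}^2/(-16)^k \equiv \binom{2m}{k}\binom{2m+k}{k}$ modulo $p^2$, and the
  alternating sum of the right-hand sides is 1; averaging the two sums shows that the sum in question is congruent to
  $(1 + D)/2$.

  The number $a$ enters through Jacobsthal's sum $S(k) = \sum_x \left(\frac{x(x^2-k)}{p}\right)$. For a
  nonresidue $\nu$, $S(1)^2 + S(\nu)^2 = 4p$, and an orbit count gives
  $S(1) \equiv 4m - 2$ modulo 8; by uniqueness of $p = a^2 + b^2$, $S(1) = -2(-1)^m a$.

  Modulo $p^2$, replace the Legendre symbol by a power with exponent $p(p-1)/2$ and sum over the
  Teichmueller representatives $x^p$, where power sums are trivial. Expanding by the binomial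
  theorem expresses $S(1)$ by the same sum that occurs in
  $D = [z^{2m}] (1-z^2)^{2m} (1+z)^{-p}$, and yields $S(1) D \equiv -D^2 - p$. As
  $D$ is prime to $p$, this determines $D \equiv -S(1) + p/S(1)$ modulo $p^2$.
\<close>

section \<open>Elementary number theory\<close>

text \<open>Euler's criterion holds only modulo p and would give no more than Gauss's congruence 2a
  = (2m choose m) modulo p. Raising it to the p-th power lifts it to modulus p^2 without changing
  the Legendre symbol, whose values -1, 0, 1 are fixed by odd powers; this is the origin of the
  exponent p(p-1)/2. The second obstacle is the first-order term \<open>U\<close> of D. It is never
  evaluated: the expansion of S(1) contains the same \<open>U\<close> with the opposite sign, so
  that eliminating it leaves S(1) = -D - p Z/2 modulo p^2. The leftover \<open>Z\<close> belongs to
  those exponents for which the inner sum runs over all j, hence is a complete alternating sum that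
  partial fractions turn into factorials, and Wilson's theorem gives Z D = 2 modulo p. This one
  congruence does two things: multiplied into the relation it removes \<open>Z\<close>, and it shows
  that D is prime to p.\<close>

text \<open>Since p divides (ad - bc)(ad + bc), it divides one factor, and replacing c by -c
  exchanges the two. Brahmagupta's identity then leaves no room for a nonzero multiple of p, so ad =
  bc.\<close>

lemma sum_two_squares_unique:
  fixes a b c d :: int
  assumes p: "prime p" and ab: "p = a\<^sup>2 + b\<^sup>2" and cd: "p = c\<^sup>2 + d\<^sup>2" and odd: "odd p" "odd a" "odd c"
  shows "a\<^sup>2 = c\<^sup>2"
proof -
  have p0: "p > 0" using p by (rule prime_gt_0_int)
  have "odd (a\<^sup>2 + b\<^sup>2)" "odd (c\<^sup>2 + d\<^sup>2)" using odd(1) ab cd by metis+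
  hence b: "even b" and d: "even d" using odd by auto
  \<comment> \<open>Stated for arbitrary c and d because it is applied to c and to -c.\<close>
  have main: "a\<^sup>2 = c\<^sup>2" if cd: "p = c\<^sup>2 + d\<^sup>2" and dvd: "p dvd a * d - b * c" and d: "even d" and c: "odd c" for c d
  proof -
    have id: "(a * c + b * d)\<^sup>2 + (a * d - b * c)\<^sup>2 = p * p"
    proof -
      have "(a * c + b * d)\<^sup>2 + (a * d - b * c)\<^sup>2 = (a\<^sup>2 + b\<^sup>2) * (c\<^sup>2 + d\<^sup>2)"
        by (simp add: power2_eq_square algebra_simps)
      thus ?thesis using ab cd by simp
    qed
    obtain k where k: "a * d - b * c = p * k" using dvd by auto
    \<comment> \<open>Parity makes the other square in the identity strictly positive, which gives
      the strict bound |ad - bc| < p.\<close>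
    have "odd (a * c + b * d)" using b d c odd by simp
    hence "a * c + b * d \<noteq> 0" by (metis even_zero)
    hence "(a * c + b * d)\<^sup>2 > 0" by simp
    hence "(p * k)\<^sup>2 < p * p" using id[unfolded k] by linarith
    hence "p * p * k\<^sup>2 < p * p * 1" by (simp add: power2_eq_square mult_ac)
    hence "k\<^sup>2 < 1" using p0 by (simp add: mult_less_cancel_left)
    hence "k = 0" by (simp add: abs_square_less_1)
    hence eq: "a * d = b * c" using k by simp
    have "p * a\<^sup>2 = a\<^sup>2 * c\<^sup>2 + (a * d)\<^sup>2" unfolding cd by (simp add: power2_eq_square algebra_simps)
    also have "\<dots> = p * c\<^sup>2" unfolding eq ab by (simp add: power2_eq_square algebra_simps)
    finally show ?thesis using p0 by simp
  qed
  have "(a * d - b * c) * (a * d + b * c) = p * (d\<^sup>2 - b\<^sup>2)"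
  proof -
    have "(a * d - b * c) * (a * d + b * c) = (a\<^sup>2 + b\<^sup>2) * d\<^sup>2 - b\<^sup>2 * (c\<^sup>2 + d\<^sup>2)"
      by (simp add: power2_eq_square algebra_simps)
    thus ?thesis unfolding ab[symmetric] cd[symmetric] by (simp add: algebra_simps)
  qed
  hence "p dvd (a * d - b * c) * (a * d + b * c)" by simp
  hence "p dvd a * d - b * c \<or> p dvd a * d - b * (- c)"
    using p by (simp add: prime_dvd_mult_iff)
  thus ?thesis using main[OF cd _ d odd(3)] main[of "- c" d] cd d odd(3) by auto
qed

text \<open>In a^p - b^p = (a - b) times a sum of p terms, each term is congruent to b^(p-1), so
  both factors are divisible by p.\<close>

lemma cong_power_lift:
  assumes "[a = b] (mod int p)"
  shows "[a ^ p = b ^ p] (mod (int p ^ 2))"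
proof -
  have "[(\<Sum>i<p. b ^ (p - Suc i) * a ^ i) = (\<Sum>i<p. b ^ (p - Suc i) * b ^ i)] (mod int p)"
    by (intro cong_sum cong_scalar_left cong_pow assms)
  also have "(\<Sum>i<p. b ^ (p - Suc i) * b ^ i) = (\<Sum>i<p. b ^ (p - 1))"
    by (intro sum.cong refl) (simp flip: power_add)
  also have "[\<dots> = 0] (mod int p)" by (simp add: cong_0_iff)
  finally have "int p dvd (\<Sum>i<p. b ^ (p - Suc i) * a ^ i)" by (simp add: cong_0_iff)
  moreover have "int p dvd a - b" using assms by (simp add: cong_iff_dvd_diff)
  ultimately have "int p * int p dvd (a - b) * (\<Sum>i<p. b ^ (p - Suc i) * a ^ i)"
    by (rule mult_dvd_mono[rotated])
  thus ?thesis by (simp add: cong_iff_dvd_diff power_diff_sumr2 power2_eq_square)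
qed

text \<open>Wilson's theorem is the case k = 0. Each further step moves the factor p - 1 - k,
  congruent to -(k + 1), from one factorial to the other.\<close>

lemma wilson_complement:
  assumes "prime p" "k < p"
  shows "[fact (p - 1 - k) * fact k = (-1) ^ Suc k] (mod int p)"
  using assms(2)
proof (induction k)
  case 0
  then show ?case using wilson_theorem[OF assms(1)] by simp
next
  case (Suc k)
  have eq: "p - 1 - k = Suc (p - 1 - Suc k)" using Suc.prems by simp
  have "[int (p - 1 - k) = - int (Suc k)] (mod int p)"
    using Suc.prems by (simp add: cong_iff_dvd_diff of_nat_diff)
  hence "[fact (p - 1 - Suc k) * fact k * int (p - 1 - k) = fact (p - 1 - Suc k) * fact k * (- int (Suc k))] (mod int p)"
    by (rule cong_scalar_left)
  moreover have "fact (p - 1 - Suc k) * fact k * int (p - 1 - k) = fact (p - 1 - k) * fact k"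
    unfolding eq by (simp only: fact_Suc) (simp add: algebra_simps)
  ultimately have "[- (fact (p - 1 - Suc k) * fact (Suc k)) = (-1) ^ Suc k] (mod int p)"
    using Suc by (simp add: algebra_simps) (metis cong_sym cong_trans)
  thus ?case by (metis cong_minus_minus_iff minus_minus mult_minus1 power_Suc)
qed

section \<open>Congruences between p-integral rational numbers\<close>

locale prime_localization =
  fixes p :: nat
  assumes prime_p: "prime p"
begin

definition integral :: "rat \<Rightarrow> bool" where
  "integral x \<longleftrightarrow> (\<exists>u v :: int. v \<noteq> 0 \<and> coprime v (int p) \<and> x = of_int u / of_int v)"

text \<open>Congruence as integrality of a quotient: closure properties of the local ring become
  rules for congruences, and squaring a congruence to 0 modulo p at once gives one modulo
  p^2.\<close>

definition pcong :: "nat \<Rightarrow> rat \<Rightarrow> rat \<Rightarrow> bool" where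
  "pcong k x y \<longleftrightarrow> integral ((x - y) / of_nat p ^ k)"

lemma p_pos [simp]: "0 < p" and p_nonzero [simp]: "p \<noteq> 0"
  using prime_p by (auto simp: prime_gt_0_nat)

lemma integral_of_int [simp, intro]: "integral (of_int u)"
  unfolding integral_def by (rule exI[of _ u], rule exI[of _ 1]) auto

lemma integral_of_nat [simp, intro]: "integral (of_nat u)"
  using integral_of_int[of "int u"] by simp

lemma integral_0 [simp]: "integral 0" and integral_1 [simp]: "integral 1"
  and integral_numeral [simp]: "integral (numeral w)"
  using integral_of_nat[of 0] integral_of_nat[of 1] integral_of_nat[of "numeral w"] by simp_all

lemma integral_mult [intro]: "integral x \<Longrightarrow> integral y \<Longrightarrow> integral (x * y)"
  unfolding integral_def
  by (clarsimp, metis coprime_mult_left_iff mult_eq_0_iff of_int_mult)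

lemma integral_add [intro]:
  assumes "integral x" "integral y" shows "integral (x + y)"
proof -
  obtain u v where 1: "v \<noteq> 0" "coprime v (int p)" "x = of_int u / of_int v"
    using assms unfolding integral_def by blast
  obtain u' v' where 2: "v' \<noteq> 0" "coprime v' (int p)" "y = of_int u' / of_int v'"
    using assms unfolding integral_def by blast
  have "x + y = of_int (u * v' + u' * v) / of_int (v * v')"
    using 1 2 by (simp add: field_simps)
  moreover have "v * v' \<noteq> 0" "coprime (v * v') (int p)" using 1 2 by simp_all
  ultimately show ?thesis unfolding integral_def by blast
qed

lemma integral_minus [intro]: "integral x \<Longrightarrow> integral (- x)"
  using integral_mult[OF integral_of_int[of "-1"], of x] by simp

lemma integral_diff [intro]: "integral x \<Longrightarrow> integral y \<Longrightarrow> integral (x - y)"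
  using integral_add[of x "- y"] by auto

lemma integral_power [intro]: "integral x \<Longrightarrow> integral (x ^ k)"
  by (induction k) auto

lemma integral_sign [simp, intro]: "integral ((-1) ^ k)"
  by (intro integral_power integral_minus integral_1)

lemma integral_sum [intro]: "(\<And>i. i \<in> A \<Longrightarrow> integral (f i)) \<Longrightarrow> integral (sum f A)"
  by (induction A rule: infinite_finite_induct) auto

lemma integral_inverse [intro]:
  assumes "\<not> int p dvd a" shows "integral (inverse (of_int a))"
proof -
  have "coprime a (int p)"
    using assms prime_p by (metis coprime_commute prime_imp_coprime prime_nat_int_transfer)
  moreover have "a \<noteq> 0" using assms by auto
  ultimately show ?thesis unfolding integral_def
    by (intro exI[of _ 1] exI[of _ a]) (simp add: field_simps)
qed

lemma integral_divide [intro]: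
  "integral x \<Longrightarrow> \<not> int p dvd a \<Longrightarrow> integral (x / of_int a)"
  by (simp add: divide_inverse integral_mult integral_inverse)

lemma integral_divide_nat [intro]:
  "integral x \<Longrightarrow> \<not> p dvd a \<Longrightarrow> integral (x / of_nat a)"
  using integral_divide[of x "int a"] by simp

lemma pcong_refl [simp, intro]: "pcong k x x"
  by (simp add: pcong_def)

lemma pcong_sym: "pcong k x y \<Longrightarrow> pcong k y x"
  unfolding pcong_def using integral_minus[of "(x - y) / of_nat p ^ k"]
  by (simp add: minus_divide_left)

lemma pcong_trans [trans]: "pcong k x y \<Longrightarrow> pcong k y z \<Longrightarrow> pcong k x z"
  unfolding pcong_def using integral_add[of "(x - y) / of_nat p ^ k" "(y - z) / of_nat p ^ k"]
  by (simp add: diff_divide_distrib)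

lemma pcong_add: "pcong k x y \<Longrightarrow> pcong k x' y' \<Longrightarrow> pcong k (x + x') (y + y')"
  unfolding pcong_def using integral_add[of "(x - y) / of_nat p ^ k" "(x' - y') / of_nat p ^ k"]
  by (simp add: diff_divide_distrib add_divide_distrib algebra_simps)

lemma pcong_minus: "pcong k x y \<Longrightarrow> pcong k (- x) (- y)"
  unfolding pcong_def using integral_minus[of "(x - y) / of_nat p ^ k"]
  by (simp add: diff_divide_distrib)

lemma pcong_diff: "pcong k x y \<Longrightarrow> pcong k x' y' \<Longrightarrow> pcong k (x - x') (y - y')"
  using pcong_add[of k x y "- x'" "- y'"] pcong_minus by auto

lemma pcong_lmult: "integral c \<Longrightarrow> pcong k x y \<Longrightarrow> pcong k (c * x) (c * y)"
  unfolding pcong_def using integral_mult[of c "(x - y) / of_nat p ^ k"]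
  by (simp add: right_diff_distrib)

text \<open>xx' - yy' = x(x' - y') + y'(x - y), so integrality of one entry from each pair is what
  is asked for.\<close>

lemma pcong_mult:
  assumes "pcong k x y" "pcong k x' y'" "integral x" "integral y'"
  shows "pcong k (x * x') (y * y')"
proof -
  have "pcong k (x * x') (x * y')" using assms by (intro pcong_lmult)
  moreover have "pcong k (y' * x) (y' * y)" using assms by (intro pcong_lmult)
  ultimately show ?thesis by (metis pcong_trans mult.commute)
qed

lemma pcong_divide:
  "pcong k x y \<Longrightarrow> \<not> int p dvd c \<Longrightarrow> pcong k (x / of_int c) (y / of_int c)"
  using pcong_lmult[of "inverse (of_int c)" k x y] by (simp add: divide_inverse mult.commute integral_inverse)

lemma pcong_divide_nat:
  "pcong k x y \<Longrightarrow> \<not> p dvd c \<Longrightarrow> pcong k (x / of_nat c) (y / of_nat c)"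
  using pcong_divide[of k x y "int c"] by simp

lemma pcong_sum: "(\<And>i. i \<in> A \<Longrightarrow> pcong k (f i) (g i)) \<Longrightarrow> pcong k (sum f A) (sum g A)"
  by (induction A rule: infinite_finite_induct) (auto intro: pcong_add)

text \<open>Inside a term that already carries a factor p, working modulo p is enough; all
  first-order terms are simplified through this rule.\<close>

lemma pcong_p_mult: "pcong 1 x y \<Longrightarrow> pcong 2 (of_nat p * x) (of_nat p * y)"
  unfolding pcong_def by (simp add: power2_eq_square flip: right_diff_distrib)

lemma pcong_weaken:
  assumes "pcong k x y" "j \<le> k" shows "pcong j x y"
proof -
  have "(x - y) / of_nat p ^ j = of_nat p ^ (k - j) * ((x - y) / of_nat p ^ k)"
    using assms(2) by (simp add: power_diff)
  moreover have "integral (of_nat p ^ (k - j) * ((x - y) / of_nat p ^ k))"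
    using assms(1) unfolding pcong_def by (intro integral_mult integral_power integral_of_nat)
  ultimately show ?thesis unfolding pcong_def by (simp only:)
qed

lemma pcong_p_mult_0: "integral x \<Longrightarrow> pcong k (of_nat p ^ k * x) 0"
  unfolding pcong_def by simp

lemma pcong_integral: "pcong k x y \<Longrightarrow> integral y \<Longrightarrow> integral x"
  using pcong_weaken[of k x y 0] integral_add[of "x - y" y] unfolding pcong_def by simp

lemma pcong_of_int:
  assumes "[a = b] (mod (int p ^ k))" shows "pcong k (of_int a) (of_int b)"
proof -
  obtain c where "a - b = int p ^ k * c"
    using assms by (metis cong_iff_dvd_diff dvdE)
  hence "rat_of_int a - of_int b = of_nat p ^ k * of_int c"
    by (metis of_int_diff of_int_mult of_int_of_nat_eq of_int_power)
  thus ?thesis unfolding pcong_def by simp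
qed

lemma pcong_cancel:
  assumes "pcong k (of_int c * x) (of_int c * y)" "\<not> int p dvd c" shows "pcong k x y"
proof -
  have "c \<noteq> 0" using assms by auto
  thus ?thesis using pcong_divide[OF assms] by simp
qed

lemma pcong_imp_rat_cong:
  assumes "pcong k x y" "k > 0" shows "rat_cong x y (int p ^ k)"
proof -
  obtain u v where v: "v \<noteq> 0" "coprime v (int p)"
    and eq: "(x - y) / of_nat p ^ k = (of_int u / of_int v :: rat)"
    using assms unfolding pcong_def integral_def by blast
  have "x - y = of_int (int p ^ k * u) / of_int v"
    using eq by (simp add: field_simps)
  thus ?thesis unfolding rat_cong_def using v
    by (intro exI[of _ "int p ^ k * u"] exI[of _ v]) auto
qed

lemma not_dvd_less: "0 < k \<Longrightarrow> k < p \<Longrightarrow> \<not> p dvd k"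
  by (auto dest: dvd_imp_le)

end

section \<open>Binomial sums\<close>

text \<open>By upper negation (-1)^k (n+k choose k) = (-n-1 choose k), so Vandermonde's convolution
  sums the series to (-1 choose n).\<close>

lemma sum_binomial_alternating_central:
  "(\<Sum>k\<le>n. (-1) ^ k * of_nat ((n choose k) * ((n + k) choose k))) = (-1 :: rat) ^ n"
proof -
  have "(\<Sum>k\<le>n. (-1) ^ k * of_nat ((n choose k) * ((n + k) choose k)) :: rat)
      = (\<Sum>k\<le>n. ((- of_nat (n + 1)) gchoose k) * (of_nat n gchoose (n - k)))"
  proof (rule sum.cong)
    fix k assume "k \<in> {..n}"
    hence "(n choose (n - k)) = (n choose k)" by (metis atMost_iff binomial_symmetric)
    moreover have "(- of_nat (n + 1) :: rat) gchoose k = (-1) ^ k * (of_nat (n + k) gchoose k)"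
      by (subst gbinomial_minus) (simp add: algebra_simps)
    ultimately show "(-1) ^ k * of_nat ((n choose k) * ((n + k) choose k))
        = ((- of_nat (n + 1) :: rat) gchoose k) * (of_nat n gchoose (n - k))"
      by (simp add: binomial_gbinomial[symmetric] del: of_nat_add)
  qed simp
  also have "\<dots> = (- of_nat (n + 1) + of_nat n :: rat) gchoose n"
    using gbinomial_Vandermonde[of "- of_nat (n + 1) :: rat" "of_nat n" n]
    by (simp add: atMost_atLeast0 del: of_nat_add)
  also have "\<dots> = (-1) ^ n"
    using gbinomial_minus[of "1 :: rat" n] by (simp add: binomial_gbinomial[symmetric])
  finally show ?thesis .
qed

text \<open>Compare the coefficients of $z^n$ in
  $(1-z)^n (1+z)^{-n-1} = (1-z^2)^n (1+z)^{-2n-1}$.\<close>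

lemma sum_binomial_central_eq:
  "(-1) ^ n * (\<Sum>k\<le>n. of_nat ((n choose k) * ((n + k) choose k)) :: rat)
    = (\<Sum>j\<le>n div 2. (-1) ^ j * of_nat (n choose j) * ((- of_nat (2 * n + 1)) gchoose (n - 2 * j)))"
proof -
  define A :: "rat fps" where "A = fps_binomial (- of_nat (n + 1))"
  define B :: "rat fps" where "B = fps_binomial (- of_nat (2 * n + 1))"
  have pow: "(1 - f) ^ n = (\<Sum>i\<le>n. fps_const ((-1) ^ i * of_nat (n choose i)) * f ^ i)"
    for f :: "rat fps"
  proof -
    have "(1 - f) ^ n = (- f + 1) ^ n" by simp
    also have "\<dots> = (\<Sum>i\<le>n. of_nat (n choose i) * (- f) ^ i)"
      by (subst binomial_ring) simp
    also have "\<dots> = (\<Sum>i\<le>n. fps_const ((-1) ^ i * of_nat (n choose i)) * f ^ i)"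
      by (intro sum.cong refl, subst power_minus)
         (simp add: fps_of_nat[symmetric] fps_const_mult[symmetric] fps_const_power[symmetric] fps_const_neg[symmetric]
           mult_ac del: fps_const_mult fps_const_power fps_const_neg)
    finally show ?thesis .
  qed
  have nthpow: "fps_nth ((1 - fps_X) ^ n :: rat fps) i = (-1) ^ i * of_nat (n choose i)" for i
    unfolding pow by (cases "i \<le> n")
      (auto simp: fps_sum_nth fps_X_power_mult_right_nth if_distrib cong: if_cong)
  have "A = (1 + fps_X) ^ n * B"
    unfolding A_def B_def fps_binomial_of_nat[symmetric]
    by (subst fps_binomial_add_mult[symmetric]) (simp add: algebra_simps)
  moreover have "(1 - f) * (1 + f) = 1 - f ^ 2" for f :: "rat fps"
    by (simp add: algebra_simps power2_eq_square)
  ultimately have "(1 - fps_X) ^ n * A = (1 - fps_X ^ 2) ^ n * B"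
    by (simp only: mult.assoc[symmetric] power_mult_distrib[symmetric])
  hence "fps_nth ((1 - fps_X) ^ n * A) n = fps_nth ((1 - fps_X ^ 2) ^ n * B) n" by simp
  also have "fps_nth ((1 - fps_X) ^ n * A) n = (\<Sum>k\<le>n. fps_nth A k * fps_nth ((1 - fps_X) ^ n) (n - k))"
    by (subst mult.commute) (simp add: fps_mult_nth atMost_atLeast0)
  also have "\<dots> = (\<Sum>k\<le>n. (-1) ^ n * of_nat ((n choose k) * ((n + k) choose k)))"
  proof (rule sum.cong)
    fix k assume k: "k \<in> {..n}"
    hence "(n choose (n - k)) = (n choose k)" by (metis atMost_iff binomial_symmetric)
    moreover have "(- of_nat (n + 1) :: rat) gchoose k = (-1) ^ k * (of_nat (n + k) gchoose k)"
      by (subst gbinomial_minus) (simp add: algebra_simps)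
    moreover have "(-1 :: rat) ^ k * (-1) ^ (n - k) = (-1) ^ n"
      using k by (simp flip: power_add)
    ultimately show "fps_nth A k * fps_nth ((1 - fps_X) ^ n) (n - k) = (-1) ^ n * of_nat ((n choose k) * ((n + k) choose k))"
      unfolding A_def nthpow fps_binomial_nth
      by (simp add: binomial_gbinomial[symmetric] mult_ac del: of_nat_add)
  qed simp
  also have "fps_nth ((1 - fps_X ^ 2) ^ n * B) n
      = (\<Sum>j\<le>n. if n < 2 * j then 0 else (-1) ^ j * of_nat (n choose j) * ((- of_nat (2 * n + 1)) gchoose (n - 2 * j)))"
    unfolding pow power_mult[symmetric] sum_distrib_right fps_sum_nth B_def
    by (intro sum.cong refl) (simp add: mult.assoc fps_X_power_mult_nth)
  also have "\<dots> = (\<Sum>j\<le>n div 2. (-1) ^ j * of_nat (n choose j) * ((- of_nat (2 * n + 1)) gchoose (n - 2 * j)))"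
    by (rule sum.mono_neutral_cong_right) auto
  finally show ?thesis by (simp add: sum_distrib_left)
qed

text \<open>The partial fraction expansion of N! / (y(y-1)...(y-N)), up to sign. By Pascal's rule
  the sum S satisfies S(N+1, y) = S(N, y) - S(N, y-1), and the right-hand side obeys the same
  recurrence.\<close>

lemma sum_binomial_partial_fraction:
  fixes y :: "'a :: field_char_0"
  assumes "\<And>j. j \<le> N \<Longrightarrow> y \<noteq> of_nat j"
  shows "(\<Sum>j\<le>N. (-1) ^ j * of_nat (N choose j) / (y - of_nat j))
       = (-1) ^ N * fact N / (\<Prod>j\<le>N. y - of_nat j)"
  using assms
proof (induction N arbitrary: y)
  case 0
  then show ?case by simp
next
  case (Suc N)
  have ne: "y - of_nat j \<noteq> 0" if "j \<le> Suc N" for j using Suc.prems that by auto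
  have ne': "y - 1 - of_nat j \<noteq> 0" if "j \<le> N" for j using ne[of "Suc j"] that by (simp add: algebra_simps)
  define P where "P = (\<Prod>j\<le>N. y - of_nat j)"
  define Q where "Q = (\<Prod>j\<le>N. y - 1 - of_nat j)"
  \<comment> \<open>Both sides are the product over j = 0, ..., N+1, with the first or the last
    factor split off.\<close>
  have PQ: "y * Q = P * (y - of_nat (Suc N))"
  proof -
    have "(\<Prod>j\<le>Suc N. y - of_nat j) = y * Q"
      unfolding Q_def by (subst prod.atMost_Suc_shift) (simp add: algebra_simps)
    thus ?thesis unfolding P_def by simp
  qed
  have P0: "P \<noteq> 0" "Q \<noteq> 0" using ne ne' by (auto simp: P_def Q_def)
  have y0: "y \<noteq> 0" "y - of_nat (Suc N) \<noteq> 0" using ne[of 0] ne[of "Suc N"] by auto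
  have "(\<Sum>j\<le>Suc N. (-1) ^ j * of_nat (Suc N choose j) / (y - of_nat j))
      = 1 / y + (\<Sum>j\<le>N. (-1) ^ Suc j * of_nat (Suc N choose Suc j) / (y - of_nat (Suc j)))"
    by (subst sum.atMost_Suc_shift) simp
  also have "(\<Sum>j\<le>N. (-1) ^ Suc j * of_nat (Suc N choose Suc j) / (y - of_nat (Suc j)))
     = (\<Sum>j\<le>N. (-1) ^ Suc j * of_nat (N choose Suc j) / (y - of_nat (Suc j)))
       - (\<Sum>j\<le>N. (-1) ^ j * of_nat (N choose j) / (y - 1 - of_nat j))"
    unfolding sum_subtractf[symmetric]
    by (intro sum.cong refl) (simp add: algebra_simps diff_divide_distrib add_divide_distrib)
  \<comment> \<open>The summand 1/y is the missing term j = 0, and (N choose N+1) = 0 allows the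
    upper limit N+1.\<close>
  also have "1 / y + ((\<Sum>j\<le>N. (-1) ^ Suc j * of_nat (N choose Suc j) / (y - of_nat (Suc j))) - (\<Sum>j\<le>N. (-1) ^ j * of_nat (N choose j) / (y - 1 - of_nat j)))
     = (\<Sum>j\<le>Suc N. (-1) ^ j * of_nat (N choose j) / (y - of_nat j)) - (\<Sum>j\<le>N. (-1) ^ j * of_nat (N choose j) / (y - 1 - of_nat j))"
    by (subst sum.atMost_Suc_shift[of _ N]) simp
  also have "\<dots> = (-1) ^ N * fact N / P - (-1) ^ N * fact N / Q"
  proof -
    have "y \<noteq> of_nat j" if "j \<le> N" for j using ne[of j] that by simp
    moreover have "y - 1 \<noteq> of_nat j" if "j \<le> N" for j using ne'[of j] that by auto
    ultimately show ?thesis using Suc.IH[of y] Suc.IH[of "y - 1"]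
      by (simp add: P_def Q_def)
  qed
  also have "\<dots> = (-1) ^ N * fact N * (Q - P) / (P * Q)" using P0 by (simp add: field_simps)
  also have "\<dots> = (-1) ^ N * fact N * (Q - P) * (y - of_nat (Suc N)) / (P * (y - of_nat (Suc N)) * Q)"
    using y0 by simp
  also have "(-1) ^ N * fact N * (Q - P) * (y - of_nat (Suc N)) = (-1) ^ N * fact N * (Q * (y - of_nat (Suc N)) - y * Q)"
    unfolding PQ by (simp add: algebra_simps)
  also have "\<dots> = (-1) ^ Suc N * fact (Suc N) * Q" by (simp add: algebra_simps)
  also have "\<dots> / (P * (y - of_nat (Suc N)) * Q) = (-1) ^ Suc N * fact (Suc N) / (\<Prod>j\<le>Suc N. y - of_nat j)"
    using P0 by (simp add: P_def)
  finally show ?case .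
qed

section \<open>Binomial coefficients with upper entry near a multiple of p\<close>

context prime_localization
begin

text \<open>The factors pe - 1 - i of the numerator are congruent to -(i+1), and l < p keeps the
  factors i+1 of the denominator invertible. The cases e = 1 and e = -1 serve the expansions of S(1)
  and of D respectively.\<close>

lemma pcong_gbinomial_multiple_minus_1:
  assumes "integral e" "l < p"
  shows "pcong 1 ((of_nat p * e - 1) gchoose l) ((-1) ^ l)"
  using assms(2)
proof (induction l)
  case 0
  then show ?case by simp
next
  case (Suc l)
  let ?a = "of_nat p * e - 1"
  have nd: "\<not> p dvd Suc l" using Suc.prems by (intro not_dvd_less) auto
  have "?a gchoose Suc l = (?a gchoose l) * (?a - of_nat l) / of_nat (Suc l)"
    using gbinomial_mult_1[of ?a l] by (simp add: field_simps del: of_nat_Suc)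
  also have "pcong 1 \<dots> ((-1) ^ l * (- of_nat (Suc l)) / of_nat (Suc l))"
  proof (rule pcong_divide_nat[OF pcong_mult nd])
    show 1: "pcong 1 (?a gchoose l) ((-1) ^ l)" using Suc by simp
    show "pcong 1 (?a - of_nat l) (- of_nat (Suc l))"
      using assms(1) by (simp add: pcong_def)
    show "integral (?a gchoose l)"
      by (rule pcong_integral[OF 1]) simp
  qed (auto simp del: of_nat_Suc)
  also have "(-1) ^ l * (- of_nat (Suc l)) / of_nat (Suc l) = (-1 :: rat) ^ Suc l"
    by (simp del: of_nat_Suc)
  finally show ?case .
qed

text \<open>Absorption (p choose i) = (p/i)(p-1 choose i-1) extracts the factor p, after which the
  other factor matters only modulo p.\<close>

lemma pcong_binomial_prime:
  assumes "0 < i" "i < p"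
  shows "pcong 2 (of_nat (p choose i)) (of_nat p * ((-1) ^ (i - 1) / of_nat i))"
proof -
  have "pcong 1 ((of_nat p * 1 - 1) gchoose (i - 1)) ((-1) ^ (i - 1))"
    using assms by (intro pcong_gbinomial_multiple_minus_1) auto
  hence "pcong 1 (((of_nat p * 1 - 1) gchoose (i - 1)) / of_nat i) ((-1) ^ (i - 1) / of_nat i)"
    using assms by (intro pcong_divide_nat not_dvd_less)
  hence "pcong 2 (of_nat p * (((of_nat p * 1 - 1) gchoose (i - 1)) / of_nat i)) (of_nat p * ((-1) ^ (i - 1) / of_nat i))"
    by (rule pcong_p_mult)
  thus ?thesis using gbinomial_absorption'[of i "of_nat p :: rat"] assms
    by (simp add: binomial_gbinomial)
qed

text \<open>The same absorption with upper entry -p.\<close>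

lemma pcong_gbinomial_minus_prime:
  assumes "0 < i" "i < p"
  shows "pcong 2 ((- of_nat p) gchoose i) (of_nat p * ((-1) ^ i / of_nat i))"
proof -
  have "pcong 1 ((of_nat p * (-1) - 1) gchoose (i - 1)) ((-1) ^ (i - 1))"
    using assms by (intro pcong_gbinomial_multiple_minus_1 integral_minus) auto
  hence "pcong 1 (- ((of_nat p * (-1) - 1) gchoose (i - 1)) / of_nat i) (- ((-1) ^ (i - 1)) / of_nat i)"
    using assms by (intro pcong_divide_nat not_dvd_less pcong_minus)
  hence "pcong 2 (of_nat p * (- ((of_nat p * (-1) - 1) gchoose (i - 1)) / of_nat i)) (of_nat p * (- ((-1) ^ (i - 1)) / of_nat i))"
    by (rule pcong_p_mult)
  also have "- ((-1 :: rat) ^ (i - 1)) = (-1) ^ i" using assms(1) by (cases i) auto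
  finally show ?thesis using gbinomial_absorption'[of i "- of_nat p :: rat"] assms by simp
qed

end

lemma central_binomial_Suc:
  "of_nat (2 * Suc k choose Suc k) = (of_nat (2 * k choose k) * (2 * (2 * of_nat k + 1) / of_nat (Suc k)) :: 'a :: field_char_0)"
proof -
  have 1: "Suc k * (2 * Suc k choose Suc k) = 2 * Suc k * (Suc (2 * k) choose k)"
    using Suc_times_binomial_eq[of "Suc (2 * k)" k] by (simp add: algebra_simps)
  have "Suc (2 * k) choose k = (Suc (2 * k) choose Suc k)"
    using binomial_symmetric[of k "Suc (2 * k)"] by simp
  moreover have "Suc k * (Suc (2 * k) choose Suc k) = Suc (2 * k) * (2 * k choose k)"
    using Suc_times_binomial_eq[of "2 * k" k] by (simp add: algebra_simps)
  ultimately have "Suc k * (2 * Suc k choose Suc k) = 2 * (2 * k + 1) * (2 * k choose k)"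
    using 1 by (metis (no_types, lifting) Suc_eq_plus1 mult.assoc mult.left_commute)
  hence "(of_nat (Suc k) * of_nat (2 * Suc k choose Suc k) :: 'a) = 2 * (2 * of_nat k + 1) * of_nat (2 * k choose k)"
    by (metis (mono_tags, lifting) of_nat_1 of_nat_add of_nat_mult of_nat_numeral)
  thus ?thesis by (simp add: field_simps del: of_nat_Suc)
qed

section \<open>The sum in question and the Delannoy number for p = 4m + 1\<close>

locale prime_1_mod_4 = prime_localization p for p +
  fixes m :: nat
  assumes p_eq: "p = 4 * m + 1"
begin

lemma m_pos [simp]: "0 < m" and m_nonzero [simp]: "m \<noteq> 0"
  using prime_p p_eq by (cases m; simp)+

lemma odd_p: "odd p" using p_eq by simp

lemma p_gt_2: "2 < p" using p_eq m_pos by linarith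

text \<open>Ratios of consecutive terms are compared. Because 2m = (p-1)/2, the ratio on the right
  is (p^2 - (2k+1)^2) / (4(k+1)^2); dropping p^2 gives the ratio on the left. The bound on k keeps
  k+1 invertible.\<close>

lemma pcong_central_binomial_square:
  assumes "k \<le> 2 * m"
  shows "pcong 2 (of_nat (2 * k choose k) ^ 2 / (-16) ^ k)
           (of_nat ((2 * m choose k) * ((2 * m + k) choose k)))"
  using assms
proof (induction k)
  case 0
  then show ?case by simp
next
  case (Suc k)
  define f where "f k = (of_nat (2 * k choose k) ^ 2 / (-16) ^ k :: rat)" for k
  define g where "g k = (of_nat ((2 * m choose k) * ((2 * m + k) choose k)) :: rat)" for k
  define s where "s = (- ((2 * of_nat k + 1) ^ 2) / of_nat (4 * Suc k ^ 2) :: rat)"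
  define t where "t = ((of_nat p ^ 2 - (2 * of_nat k + 1) ^ 2) / of_nat (4 * Suc k ^ 2) :: rat)"
  have "\<not> p dvd 4" using p_eq m_pos by (intro not_dvd_less) linarith+
  hence nd: "\<not> p dvd 4 * Suc k ^ 2"
    using Suc.prems p_eq prime_p not_dvd_less[of "Suc k"]
    by (auto simp: prime_dvd_mult_iff prime_dvd_power_iff simp del: power_Suc)
  have fs: "f (Suc k) = f k * s"
  proof -
    have "f (Suc k) = (of_nat (2 * k choose k) * (2 * (2 * of_nat k + 1) / of_nat (Suc k))) ^ 2 / (-16) ^ Suc k"
      unfolding f_def central_binomial_Suc ..
    also have "(c * (2 * w / K)) ^ 2 / (-16) ^ Suc k = c ^ 2 / (-16) ^ k * (- (w ^ 2) / (4 * K ^ 2))"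
      if "K \<noteq> 0" for c w K :: rat
      using that by (simp add: field_simps power2_eq_square)
    from this[of "of_nat (Suc k)" "of_nat (2 * k choose k)" "2 * of_nat k + 1"]
    have "(of_nat (2 * k choose k) * (2 * (2 * of_nat k + 1) / of_nat (Suc k))) ^ 2 / (-16) ^ Suc k = f k * s"
      unfolding f_def s_def by (simp del: of_nat_Suc)
    finally show ?thesis .
  qed
  have gt: "g (Suc k) = g k * t"
  proof -
    have 1: "of_nat (Suc k) * of_nat (2 * m choose Suc k) = ((2 * of_nat m - of_nat k) * of_nat (2 * m choose k) :: rat)"
      using gbinomial_mult_1[of "of_nat (2 * m) :: rat" k] by (simp add: binomial_gbinomial algebra_simps)
    have "of_nat ((2 * m + Suc k choose Suc k) * Suc k) = (of_nat (Suc (2 * m + k) * (2 * m + k choose k)) :: rat)"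
      using Suc_times_binomial_eq[of "2 * m + k" k] by simp
    hence 2: "of_nat (Suc k) * of_nat (2 * m + Suc k choose Suc k) = ((2 * of_nat m + of_nat k + 1) * of_nat (2 * m + k choose k) :: rat)"
      by (simp only: of_nat_mult) (simp add: algebra_simps)
    have "of_nat (Suc k) ^ 2 * g (Suc k)
       = (of_nat (Suc k) * of_nat (2 * m choose Suc k)) * (of_nat (Suc k) * of_nat (2 * m + Suc k choose Suc k))"
      unfolding g_def by (simp add: power2_eq_square del: of_nat_Suc)
    also have "\<dots> = g k * ((2 * of_nat m - of_nat k) * (2 * of_nat m + of_nat k + 1))"
      unfolding 1 2 g_def by simp
    also have "(2 * of_nat m - of_nat k) * (2 * of_nat m + of_nat k + 1) = of_nat (Suc k) ^ 2 * t"
      unfolding t_def p_eq by (simp add: field_simps del: of_nat_Suc) (simp add: algebra_simps power2_eq_square)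
    finally have "of_nat (Suc k) ^ 2 * g (Suc k) = of_nat (Suc k) ^ 2 * (g k * t)" by simp
    thus ?thesis by (simp del: of_nat_Suc)
  qed
  have ints: "integral s" "integral t" unfolding s_def t_def using nd
    by (intro integral_divide_nat integral_minus integral_power integral_add integral_mult integral_diff integral_numeral integral_of_nat integral_1; simp)+
  have "t - s = of_nat p ^ 2 * (1 / of_nat (4 * Suc k ^ 2))"
    unfolding s_def t_def by (simp add: field_simps)
  hence "pcong 2 t s" unfolding pcong_def using integral_divide_nat[OF integral_1 nd] by simp
  moreover have "pcong 2 (f k) (g k)" using Suc by (simp add: f_def g_def)
  moreover have "integral (g k)" by (simp add: g_def del: of_nat_mult)
  ultimately have "pcong 2 (f k * s) (g k * t)"
    using ints pcong_integral by (intro pcong_mult) (auto intro: pcong_sym)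
  thus ?case using fs gt by (simp add: f_def g_def)
qed

lemma pcong_minus_1: "pcong 1 (-1) (of_nat (4 * m))"
proof -
  have "(of_nat (4 * m) :: rat) = of_nat p - 1" by (simp add: p_eq)
  thus ?thesis by (simp only: pcong_def) (simp add: integral_minus)
qed

text \<open>The central Delannoy number of index 2m, equal to the value at 3 of the Legendre
  polynomial of degree 2m.\<close>

definition delannoy :: rat where
  "delannoy = (\<Sum>k\<le>2 * m. of_nat ((2 * m choose k) * ((2 * m + k) choose k)))"

lemma pcong_even_central_binomial_sum:
  "pcong 2 (\<Sum>k=0..m. of_nat ((4 * k) choose (2 * k)) ^ 2 / 16 ^ (2 * k)) ((1 + delannoy) / 2)"
proof -
  define f where "f k = (of_nat (2 * k choose k) ^ 2 / (-16) ^ k :: rat)" for k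
  define g where "g k = (of_nat ((2 * m choose k) * ((2 * m + k) choose k)) :: rat)" for k
  \<comment> \<open>Only even indices occur, where the sign of (-16)^(2k) disappears.\<close>
  have "(\<Sum>k=0..m. of_nat ((4 * k) choose (2 * k)) ^ 2 / 16 ^ (2 * k)) = (\<Sum>k=0..m. f (2 * k))"
    by (simp add: f_def)
  also have "pcong 2 \<dots> (\<Sum>k=0..m. g (2 * k))"
    unfolding f_def g_def by (intro pcong_sum pcong_central_binomial_square) auto
  also have "(\<Sum>k=0..m. g (2 * k)) = (\<Sum>k\<in>{k\<in>{..2 * m}. even k}. g k)"
    by (rule sum.reindex_bij_witness[of _ "\<lambda>k. k div 2" "\<lambda>k. 2 * k"]) auto
  also have "\<dots> = (\<Sum>k\<le>2 * m. (((-1) ^ k + 1) * g k) / 2)"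
    by (rule sum.mono_neutral_cong_left) auto
  also have "\<dots> = ((\<Sum>k\<le>2 * m. (-1) ^ k * g k) + (\<Sum>k\<le>2 * m. g k)) / 2"
    by (simp add: sum.distrib sum_divide_distrib algebra_simps add_divide_distrib)
  also have "\<dots> = (1 + delannoy) / 2"
    unfolding g_def delannoy_def sum_binomial_alternating_central by simp
  finally show ?thesis .
qed

text \<open>\<open>U\<close>, \<open>Z\<close> and, further below, \<open>V\<close> are the terms of order $p$ in the
  expansions of \<open>delannoy\<close> and \<open>jacobsthal 1\<close>.\<close>

definition U :: rat where
  "U = (\<Sum>j<m. (-1) ^ j * of_nat (2 * m choose j) / of_nat (m - j))"

text \<open>For n = 2m the exponent -2n-1 in the generating function is -p, so every coefficient (-p
  choose 2m-2j) is divisible by p except the constant one. That one, j = m, gives the main term; the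
  others give \<open>U\<close>, with positive sign since 2m-2j is even.\<close>

lemma pcong_delannoy:
  "pcong 2 delannoy ((-1) ^ m * of_nat (2 * m choose m) + of_nat p * (U / 2))"
proof -
  define F where "F j = ((-1) ^ j * of_nat (2 * m choose j) * ((- of_nat p) gchoose (2 * m - 2 * j)) :: rat)" for j
  have "delannoy = (\<Sum>j\<le>m. F j)"
    using sum_binomial_central_eq[of "2 * m"] unfolding F_def p_eq delannoy_def by simp
  also have "\<dots> = (\<Sum>j<m. F j) + (-1) ^ m * of_nat (2 * m choose m)"
    by (simp add: F_def lessThan_Suc_atMost[symmetric])
  also have "pcong 2 \<dots> ((\<Sum>j<m. (-1) ^ j * of_nat (2 * m choose j) * (of_nat p * (1 / of_nat (2 * (m - j))))) + (-1) ^ m * of_nat (2 * m choose m))"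
    unfolding F_def
  proof (intro pcong_add pcong_sum pcong_refl pcong_lmult)
    fix j assume j: "j \<in> {..<m}"
    show "integral ((-1) ^ j * of_nat (2 * m choose j))"
      by (intro integral_mult integral_power integral_minus) auto
    have "pcong 2 ((- of_nat p) gchoose (2 * m - 2 * j)) (of_nat p * ((-1) ^ (2 * m - 2 * j) / of_nat (2 * m - 2 * j)))"
      using j p_eq by (intro pcong_gbinomial_minus_prime) auto
    thus "pcong 2 ((- of_nat p) gchoose (2 * m - 2 * j)) (of_nat p * (1 / of_nat (2 * (m - j))))"
      by (simp add: right_diff_distrib'[symmetric] del: of_nat_mult)
  qed
  also have "(\<Sum>j<m. (-1) ^ j * of_nat (2 * m choose j) * (of_nat p * (1 / of_nat (2 * (m - j))))) = of_nat p * (U / 2)"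
    unfolding U_def by (simp add: sum_distrib_left sum_divide_distrib algebra_simps)
  finally show ?thesis by (simp add: add.commute)
qed

definition Z :: rat where
  "Z = (\<Sum>j<2 * m. (-1) ^ j * of_nat ((2 * m - 1) choose j) / of_nat (3 * m - j))"

lemma integral_U: "integral U"
  unfolding U_def
  by (intro integral_sum integral_divide_nat integral_mult integral_sign integral_of_nat not_dvd_less)
     (auto simp: p_eq)

lemma integral_Z: "integral Z"
  unfolding Z_def
  by (intro integral_sum integral_divide_nat integral_mult integral_sign integral_of_nat not_dvd_less)
     (auto simp: p_eq)

lemma integral_delannoy: "integral delannoy"
  unfolding delannoy_def by (intro integral_sum integral_of_nat)

lemma pcong_fact_product:
  "pcong 1 (fact (2 * m) ^ 2) (-1)" "pcong 1 (fact (3 * m) * fact m) ((-1) ^ Suc m)"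
proof -
  have "p - 1 - 2 * m = 2 * m" using p_eq by simp
  hence "[fact (2 * m) * fact (2 * m) = (-1) ^ Suc (2 * m)] (mod int p ^ 1)"
    using wilson_complement[OF prime_p, of "2 * m"] p_eq by simp
  from pcong_of_int[OF this] show "pcong 1 (fact (2 * m) ^ 2) (-1)"
    by (simp add: power2_eq_square)
  have "p - 1 - m = 3 * m" using p_eq by simp
  hence "[fact (3 * m) * fact m = (-1) ^ Suc m] (mod int p ^ 1)"
    using wilson_complement[OF prime_p, of "m"] p_eq by simp
  from pcong_of_int[OF this] show "pcong 1 (fact (3 * m) * fact m) ((-1) ^ Suc m)"
    by simp
qed

text \<open>Partial fractions with N = 2m - 1 and y = 3m; the product of the denominators is
  (m+1)...(3m) = (3m)!/m!.\<close>

lemma Z_eq: "Z * fact (3 * m) = - fact (2 * m - 1) * fact m"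
proof -
  let ?y = "of_nat (3 * m) :: rat"
  obtain q where q: "m = Suc q" using m_pos by (cases m) auto
  have eq: "{..<2 * m} = {..2 * m - 1}" by (auto simp: q)
  have "Z = (\<Sum>j\<le>2 * m - 1. (-1) ^ j * of_nat ((2 * m - 1) choose j) / (?y - of_nat j))"
    unfolding Z_def eq by (intro sum.cong) (auto simp: of_nat_diff)
  also have "\<dots> = (-1) ^ (2 * m - 1) * fact (2 * m - 1) / (\<Prod>j\<le>2 * m - 1. ?y - of_nat j)"
  proof (rule sum_binomial_partial_fraction)
    fix j assume "j \<le> 2 * m - 1"
    hence "3 * m \<noteq> j" using m_pos by linarith
    thus "?y \<noteq> of_nat j" by (metis of_nat_eq_iff)
  qed
  also have "(-1 :: rat) ^ (2 * m - 1) = - 1" by (simp add: q)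
  finally have Z: "Z = - fact (2 * m - 1) / (\<Prod>j\<le>2 * m - 1. ?y - of_nat j)" by simp
  have "(\<Prod>j\<le>2 * m - 1. ?y - of_nat j) = of_nat (\<Prod>j\<le>2 * m - 1. 3 * m - j)"
    unfolding of_nat_prod by (intro prod.cong) (auto simp: of_nat_diff)
  also have "(\<Prod>j\<le>2 * m - 1. 3 * m - j) = \<Prod>{m + 1..3 * m}"
    by (rule prod.reindex_bij_witness[of _ "\<lambda>i. 3 * m - i" "\<lambda>j. 3 * m - j"]) (auto simp: q)
  finally have P: "(\<Prod>j\<le>2 * m - 1. ?y - of_nat j) = of_nat (\<Prod>{m + 1..3 * m})" .
  have "fact (3 * m) = fact m * \<Prod>{m + 1..3 * m}"
  proof -
    have "{1..3 * m} = {1..m} \<union> {m + 1..3 * m}" by auto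
    thus ?thesis unfolding fact_prod by (simp add: prod.union_disjoint)
  qed
  hence "fact (3 * m) = (fact m * of_nat (\<Prod>{m + 1..3 * m}) :: rat)"
    by (metis of_nat_fact of_nat_mult)
  moreover have "\<Prod>{m + 1..3 * m} \<noteq> 0" by simp
  ultimately show ?thesis unfolding Z P by (simp del: of_nat_prod)
qed

text \<open>Modulo p only the main term (-1)^m (2m choose m) of D remains. Its product with the
  closed form of \<open>Z\<close> consists of factorials, which Wilson's theorem evaluates.\<close>

lemma pcong_Z_delannoy: "pcong 1 (Z * delannoy) 2"
proof -
  let ?C = "of_nat (2 * m choose m) :: rat"
  have "pcong 1 delannoy ((-1) ^ m * ?C + of_nat p * (U / 2))"
    by (rule pcong_weaken[OF pcong_delannoy]) simp
  also have "pcong 1 \<dots> ((-1) ^ m * ?C + 0)"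
  proof (intro pcong_add pcong_refl)
    have "integral (U / 2)" using integral_divide_nat[OF integral_U, of 2] p_gt_2 not_dvd_less[of 2] by simp
    from pcong_p_mult_0[OF this, of 1] show "pcong 1 (of_nat p * (U / 2)) 0" by simp
  qed
  finally have "pcong 1 (Z * delannoy) (Z * ((-1) ^ m * ?C))"
    by (intro pcong_lmult integral_Z) simp
  also have "pcong 1 (Z * ((-1) ^ m * ?C)) 2"
  proof -
    define T where "T = Z * ((-1) ^ m * ?C)"
    have C: "?C * (fact m * fact m) = fact (2 * m)"
      using binomial_fact[of m "2 * m", where 'a = rat] by (simp add: mult_2)
    have "of_nat (2 * m) * fact (2 * m - 1) = (fact (2 * m) :: rat)"
      using fact_reduce[of "2 * m", where 'a = rat] by simp
    note f = this
    \<comment> \<open>Clears all denominators: 2m completes (2m-1)! to (2m)!, (3m)! comes from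
      \<open>Z\<close>, and m! completes the denominator of the binomial coefficient.\<close>
    define c :: int where "c = int (2 * m) * (fact (3 * m) * fact m)"
    have "of_int c * T = of_nat (2 * m) * (Z * fact (3 * m)) * fact m * ((-1) ^ m * ?C)"
      unfolding c_def T_def by simp
    also have "\<dots> = (-1) ^ Suc m * (of_nat (2 * m) * fact (2 * m - 1)) * (?C * (fact m * fact m))"
      unfolding Z_eq by simp
    also have "\<dots> = (-1) ^ Suc m * fact (2 * m) ^ 2"
      unfolding C f by (simp add: power2_eq_square)
    also have "pcong 1 \<dots> ((-1) ^ Suc m * (-1))"
      by (intro pcong_lmult pcong_fact_product integral_sign)
    \<comment> \<open>Writing -1 as 4m = 2 * 2m reproduces the factor 2m of \<open>c\<close> and
      leaves the 2 of the claim.\<close>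
    also have "pcong 1 \<dots> ((-1) ^ Suc m * of_nat (4 * m))"
      by (intro pcong_lmult integral_sign pcong_minus_1)
    also have "(-1) ^ Suc m * of_nat (4 * m) = of_nat (4 * m) * (-1 :: rat) ^ Suc m" by simp
    also have "pcong 1 \<dots> (of_nat (4 * m) * (fact (3 * m) * fact m))"
      by (intro pcong_lmult integral_of_nat pcong_sym[OF pcong_fact_product(2)])
    also have "of_nat (4 * m) * (fact (3 * m) * fact m) = of_int c * (2 :: rat)"
      unfolding c_def by simp
    finally have "pcong 1 (of_int c * T) (of_int c * 2)" .
    moreover have "\<not> int p dvd c"
    proof -
      have "\<not> p dvd 2 * m" using p_eq m_pos by (intro not_dvd_less) auto
      hence "\<not> p dvd 2 * m * (fact (3 * m) * fact m)"
        using prime_p p_eq by (simp add: prime_dvd_mult_iff prime_dvd_fact_iff)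
      moreover have "c = int (2 * m * (fact (3 * m) * fact m))" by (simp add: c_def)
      ultimately show ?thesis by (metis of_nat_dvd_iff)
    qed
    ultimately show ?thesis unfolding T_def by (rule pcong_cancel)
  qed
  finally show ?thesis .
qed

section \<open>Jacobsthal sums\<close>

abbreviation \<phi> :: "int \<Rightarrow> int" where "\<phi> x \<equiv> Legendre x (int p)"

abbreviation R :: "int set" where "R \<equiv> {0..<int p}"

section \<open>The Legendre symbol and its sums over residues\<close>

lemma prime_int_p: "prime (int p)"
  using prime_p by simp

lemma legendre_cong: "[x = y] (mod int p) \<Longrightarrow> \<phi> x = \<phi> y"
  unfolding Legendre_def QuadRes_def cong_def by simp

lemma legendre_eq_0_iff: "\<phi> x = 0 \<longleftrightarrow> int p dvd x"
  unfolding Legendre_def by (auto simp: cong_0_iff)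

lemma legendre_cases: "\<phi> x = 0 \<or> \<phi> x = 1 \<or> \<phi> x = -1"
  unfolding Legendre_def by auto

lemma legendre_power2: "\<not> int p dvd x \<Longrightarrow> \<phi> x ^ 2 = 1"
  using legendre_cases[of x] legendre_eq_0_iff[of x] by auto

lemma euler: "[\<phi> x = x ^ (2 * m)] (mod int p)"
  using euler_criterion[OF prime_p p_gt_2, of x] p_eq by simp

text \<open>Two numbers among -1, 0, 1 differ by at most 2 < p, so congruence forces
  equality.\<close>

lemma legendre_eqI:
  assumes "[\<phi> x = c] (mod int p)" "c = 0 \<or> c = 1 \<or> c = -1"
  shows "\<phi> x = c"
proof (rule ccontr)
  assume ne: "\<phi> x \<noteq> c"
  from assms(1) have "int p dvd \<phi> x - c" by (simp add: cong_iff_dvd_diff)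
  hence "int p \<le> \<bar>\<phi> x - c\<bar>" using ne by (intro zdvd_imp_le) auto
  thus False using legendre_cases[of x] assms(2) p_gt_2 by auto
qed

lemma legendre_mult: "\<phi> (x * y) = \<phi> x * \<phi> y"
proof (rule legendre_eqI)
  have "[\<phi> (x * y) = x ^ (2 * m) * y ^ (2 * m)] (mod int p)"
    using euler[of "x * y"] by (simp add: power_mult_distrib)
  also have "[x ^ (2 * m) * y ^ (2 * m) = \<phi> x * \<phi> y] (mod int p)"
    by (intro cong_mult cong_sym[OF euler])
  finally show "[\<phi> (x * y) = \<phi> x * \<phi> y] (mod int p)" .
  show "\<phi> x * \<phi> y = 0 \<or> \<phi> x * \<phi> y = 1 \<or> \<phi> x * \<phi> y = -1"
    using legendre_cases[of x] legendre_cases[of y] by auto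
qed

lemma legendre_one [simp]: "\<phi> 1 = 1"
  by (rule legendre_eqI) (use euler[of 1] in simp_all)

lemma legendre_minus_one: "\<phi> (-1) = 1"
  by (rule legendre_eqI) (use euler[of "-1"] in simp_all)

lemma legendre_minus: "\<phi> (- x) = \<phi> x"
  using legendre_mult[of "-1" x] legendre_minus_one by simp

lemma legendre_eq_1D:
  assumes "\<phi> x = 1" obtains t where "[t\<^sup>2 = x] (mod int p)" "\<not> int p dvd t"
proof -
  obtain t where t: "[t\<^sup>2 = x] (mod int p)"
    using assms unfolding Legendre_def QuadRes_def by (auto split: if_splits)
  moreover have "\<not> int p dvd x" using assms legendre_eq_0_iff[of x] by auto
  hence "\<not> int p dvd t"
    using cong_dvd_iff[OF t] by (auto simp: power2_eq_square)
  ultimately show thesis using that t by blast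
qed

lemma cong_cancel:
  assumes "[c * x = c * y] (mod int p)" "\<not> int p dvd c"
  shows "[x = y] (mod int p)"
proof -
  have "coprime c (int p)"
    using assms(2) prime_int_p by (metis coprime_commute prime_imp_coprime)
  thus ?thesis using assms(1) cong_mult_lcancel by blast
qed

text \<open>A primitive root, of order 4m, is a witness. It provides a nonresidue for M = 2m and
  makes the power sums with 4m not dividing M vanish.\<close>

lemma exists_power_incongruent_1:
  assumes "\<not> (4 * m) dvd M"
  obtains t :: int where "\<not> int p dvd t" "\<not> [t ^ M = 1] (mod int p)"
proof -
  obtain g where g: "residue_primroot p g"
    using prime_primitive_root_exists[of p] prime_p prime_gt_1_nat[of p] by auto
  hence cop: "coprime g p" and ord: "ord p g = p - 1"
    using prime_p by (auto simp: residue_primroot_def totient_prime coprime_commute)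
  have "p - 1 = 4 * m" using p_eq by simp
  hence "\<not> [g ^ M = 1] (mod p)"
    using assms ord ord_divides[of g M p] by simp
  hence "\<not> [int g ^ M = 1] (mod int p)"
    using cong_int_iff[of "g ^ M" 1 p] by simp
  moreover have "\<not> p dvd g"
    using cop prime_p by (meson coprime_common_divisor dvd_refl not_prime_unit)
  hence "\<not> int p dvd int g" by simp
  ultimately show thesis using that by blast
qed

lemma exists_nonresidue: obtains \<nu> where "\<phi> \<nu> = -1"
proof -
  have "\<not> 4 * m dvd 2 * m" using m_pos by (auto dest!: dvd_imp_le)
  then obtain t :: int where "\<not> int p dvd t" "\<not> [t ^ (2 * m) = 1] (mod int p)"
    by (rule exists_power_incongruent_1)
  hence "\<phi> t = -1" using euler[of t] legendre_cases[of t] legendre_eq_0_iff[of t] cong_sym by fastforce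
  thus thesis using that by blast
qed

text \<open>Injectivity of h modulo p suffices, an injective self-map of a finite set being a
  bijection.\<close>

lemma sum_residues_reindex:
  fixes f :: "int \<Rightarrow> 'a :: comm_monoid_add"
  assumes f: "\<And>x y. [x = y] (mod int p) \<Longrightarrow> f x = f y"
    and h: "\<And>x y. [h x = h y] (mod int p) \<Longrightarrow> [x = y] (mod int p)"
  shows "(\<Sum>x\<in>R. f (h x)) = (\<Sum>x\<in>R. f x)"
proof -
  have inj: "inj_on (\<lambda>x. h x mod int p) R"
  proof (rule inj_onI)
    fix x y assume xy: "x \<in> R" "y \<in> R" "h x mod int p = h y mod int p"
    hence "[h x = h y] (mod int p)" by (simp add: cong_def)
    hence "[x = y] (mod int p)" by (rule h)
    thus "x = y" using xy cong_less_imp_eq_int by auto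
  qed
  have "(\<lambda>x. h x mod int p) ` R \<subseteq> R" by auto
  hence "bij_betw (\<lambda>x. h x mod int p) R R"
    using inj endo_inj_surj[of R] by (auto simp: bij_betw_def)
  from sum.reindex_bij_betw[OF this, of f]
  have "(\<Sum>x\<in>R. f (h x mod int p)) = (\<Sum>x\<in>R. f x)" .
  moreover have "f (h x mod int p) = f (h x)" for x by (intro f) simp
  ultimately show ?thesis by simp
qed

lemma sum_residues_scale:
  fixes f :: "int \<Rightarrow> 'a :: comm_monoid_add"
  assumes "\<And>x y. [x = y] (mod int p) \<Longrightarrow> f x = f y" "\<not> int p dvd c"
  shows "(\<Sum>x\<in>R. f (c * x)) = (\<Sum>x\<in>R. f x)"
  by (rule sum_residues_reindex, fact assms(1), rule cong_cancel[OF _ assms(2)])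

text \<open>Scaling the variable by a nonresidue negates the sum.\<close>

lemma sum_legendre: "(\<Sum>x\<in>R. \<phi> x) = 0"
proof -
  obtain \<nu> where \<nu>: "\<phi> \<nu> = -1" by (rule exists_nonresidue)
  hence "\<not> int p dvd \<nu>" using legendre_eq_0_iff[of \<nu>] by auto
  hence "(\<Sum>x\<in>R. \<phi> (\<nu> * x)) = (\<Sum>x\<in>R. \<phi> x)"
    by (intro sum_residues_scale legendre_cong)
  thus ?thesis using \<nu> by (simp add: legendre_mult sum_negf)
qed

lemma residue_dvd_iff: "x \<in> R \<Longrightarrow> int p dvd x \<longleftrightarrow> x = 0"
  by (auto dest: zdvd_imp_le)

lemma sum_legendre_power2: "(\<Sum>x\<in>R. \<phi> x ^ 2) = int p - 1"
proof -
  have "(\<Sum>x\<in>R. \<phi> x ^ 2) = (\<Sum>x\<in>R - {0}. \<phi> x ^ 2)"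
    using legendre_eq_0_iff[of 0] by (intro sum.mono_neutral_right) auto
  also have "\<dots> = (\<Sum>x\<in>R - {0}. 1)"
    by (intro sum.cong refl legendre_power2) (auto dest: zdvd_imp_le)
  also have "\<dots> = int p - 1" by (simp add: card_Diff_singleton_if of_nat_diff Suc_leI)
  finally show ?thesis .
qed

text \<open>Scaling shows that the sum J(c) is the same for all nonzero c. Its total over all c is 0
  and J(0) = p - 1, so the common value is -1.\<close>

lemma sum_legendre_shift:
  assumes "\<not> int p dvd c"
  shows "(\<Sum>k\<in>R. \<phi> k * \<phi> (k + c)) = -1"
proof -
  define J where "J c = (\<Sum>k\<in>R. \<phi> k * \<phi> (k + c))" for c
  have J1: "J c = J 1" if c: "\<not> int p dvd c" for c
  proof -
    have "J c = (\<Sum>k\<in>R. \<phi> (c * k) * \<phi> (c * k + c))" unfolding J_def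
      by (rule sum_residues_scale[symmetric, OF _ c])
         (intro arg_cong2[of _ _ _ _ "(*)"] legendre_cong cong_add cong_refl)
    also have "\<dots> = (\<Sum>k\<in>R. \<phi> c ^ 2 * (\<phi> k * \<phi> (k + 1)))"
    proof (intro sum.cong refl)
      fix k
      have "c * k + c = c * (k + 1)" by (simp add: algebra_simps)
      thus "\<phi> (c * k) * \<phi> (c * k + c) = \<phi> c ^ 2 * (\<phi> k * \<phi> (k + 1))"
        by (simp only: legendre_mult) (simp add: power2_eq_square)
    qed
    finally show ?thesis using legendre_power2[OF c] by (simp add: J_def)
  qed
  have "(\<Sum>c\<in>R. J c) = (\<Sum>k\<in>R. \<phi> k * (\<Sum>c\<in>R. \<phi> (k + c)))"
    unfolding J_def by (subst sum.swap) (simp add: sum_distrib_left)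
  also have "(\<lambda>k. \<Sum>c\<in>R. \<phi> (k + c)) = (\<lambda>k. \<Sum>c\<in>R. \<phi> c)"
    by (intro ext sum_residues_reindex legendre_cong) (auto simp: cong_add_lcancel)
  finally have "(\<Sum>c\<in>R. J c) = 0" by (simp add: sum_legendre)
  moreover have "(\<Sum>c\<in>R. J c) = J 0 + (\<Sum>c\<in>R - {0}. J c)"
    by (rule sum.remove) auto
  moreover have "(\<Sum>c\<in>R - {0}. J c) = (\<Sum>c\<in>R - {0}. J 1)"
    by (intro sum.cong refl J1) (auto dest: zdvd_imp_le)
  moreover have "J 0 = int p - 1"
    unfolding J_def using sum_legendre_power2 by (simp add: power2_eq_square)
  ultimately have "(int p - 1) * (J 1 + 1) = 0"
    by (simp add: card_Diff_singleton_if of_nat_diff Suc_leI algebra_simps)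
  hence "J 1 = -1" using p_gt_2 by auto
  thus ?thesis using J1[OF assms] by (simp add: J_def)
qed

lemma sum_legendre_two_shifts:
  "(\<Sum>k\<in>R. \<phi> (a - k) * \<phi> (b - k)) = (if [a = b] (mod int p) then int p - 1 else -1)"
proof -
  have "(\<Sum>k\<in>R. \<phi> (a - k) * \<phi> (b - k)) = (\<Sum>k\<in>R. \<phi> (a - k) * \<phi> (a - k + (b - a)))"
    by simp
  also have "\<dots> = (\<Sum>k\<in>R. \<phi> k * \<phi> (k + (b - a)))"
  proof (rule sum_residues_reindex)
    show "[x = y] (mod int p) \<Longrightarrow> \<phi> x * \<phi> (x + (b - a)) = \<phi> y * \<phi> (y + (b - a))" for x y
      by (intro arg_cong2[of _ _ _ _ "(*)"] legendre_cong cong_add cong_refl)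
    show "[a - x = a - y] (mod int p) \<Longrightarrow> [x = y] (mod int p)" for x y
      by (simp add: cong_iff_dvd_diff dvd_diff_commute)
  qed
  also have "\<dots> = (if [a = b] (mod int p) then int p - 1 else -1)"
  proof (cases "[a = b] (mod int p)")
    case True
    have "\<phi> (k + (b - a)) = \<phi> k" for k
      using True by (intro legendre_cong) (simp add: cong_iff_dvd_diff dvd_diff_commute)
    thus ?thesis using True sum_legendre_power2 by (simp add: power2_eq_square)
  next
    case False
    thus ?thesis using sum_legendre_shift[of "b - a"]
      by (simp add: cong_iff_dvd_diff dvd_diff_commute)
  qed
  finally show ?thesis .
qed

section \<open>Jacobsthal sums and the representation of 4p as a sum of two squares\<close>

definition jacobsthal :: "int \<Rightarrow> int" where
  "jacobsthal k = (\<Sum>x\<in>R. \<phi> x * \<phi> (x\<^sup>2 - k))"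

lemma jacobsthal_cong: "[k = l] (mod int p) \<Longrightarrow> jacobsthal k = jacobsthal l"
  unfolding jacobsthal_def
  by (intro sum.cong refl arg_cong2[of _ _ _ _ "(*)"] legendre_cong cong_diff cong_refl)

text \<open>The substitution of tx for x pulls out the symbol of t^3. Hence S(k)^2 depends only on
  the quadratic character of k.\<close>

lemma jacobsthal_scale:
  assumes "\<not> int p dvd t"
  shows "jacobsthal (t\<^sup>2 * k) = \<phi> t * jacobsthal k"
proof -
  have "jacobsthal (t\<^sup>2 * k) = (\<Sum>x\<in>R. \<phi> (t * x) * \<phi> ((t * x)\<^sup>2 - t\<^sup>2 * k))"
    unfolding jacobsthal_def
    by (rule sum_residues_scale[symmetric, OF _ assms])
       (intro arg_cong2[of _ _ _ _ "(*)"] legendre_cong cong_diff cong_pow cong_refl)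
  also have "\<dots> = (\<Sum>x\<in>R. \<phi> t * (\<phi> x * \<phi> (x\<^sup>2 - k)))"
  proof (intro sum.cong refl)
    fix x
    have "(t * x)\<^sup>2 - t\<^sup>2 * k = t\<^sup>2 * (x\<^sup>2 - k)" by (simp add: algebra_simps power2_eq_square)
    moreover have "\<phi> (t\<^sup>2) = 1"
      using legendre_power2[OF assms] by (simp add: power2_eq_square legendre_mult)
    ultimately show "\<phi> (t * x) * \<phi> ((t * x)\<^sup>2 - t\<^sup>2 * k) = \<phi> t * (\<phi> x * \<phi> (x\<^sup>2 - k))"
      by (simp only: legendre_mult)
  qed
  finally show ?thesis by (simp add: jacobsthal_def sum_distrib_left)
qed

lemma jacobsthal_0: "jacobsthal 0 = 0"
proof -
  have eq: "\<phi> x * \<phi> (x\<^sup>2) = \<phi> x" for x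
    using legendre_cases[of x] by (auto simp: power2_eq_square legendre_mult)
  show ?thesis by (simp only: jacobsthal_def diff_zero eq sum_legendre)
qed

lemma cong_square_imp:
  assumes "[x\<^sup>2 = y\<^sup>2] (mod int p)"
  shows "[x = y] (mod int p) \<or> [x = - y] (mod int p)"
proof -
  have "x\<^sup>2 - y\<^sup>2 = (x - y) * (x + y)"
    by (simp add: power2_eq_square algebra_simps)
  hence "int p dvd (x - y) * (x + y)"
    using assms by (simp add: cong_iff_dvd_diff)
  thus ?thesis using prime_int_p by (simp add: prime_dvd_mult_iff cong_iff_dvd_diff)
qed

lemma residues_with_square:
  assumes "x \<in> R" "x \<noteq> 0"
  shows "{y \<in> R. [x\<^sup>2 = y\<^sup>2] (mod int p)} = {x, int p - x}"
proof (intro equalityI subsetI)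
  fix y assume y: "y \<in> {y \<in> R. [x\<^sup>2 = y\<^sup>2] (mod int p)}"
  hence "int p dvd x - y \<or> int p dvd x + y"
    using cong_square_imp[of x y] by (simp add: cong_iff_dvd_diff)
  thus "y \<in> {x, int p - x}"
  proof
    assume "int p dvd x - y"
    hence "[x = y] (mod int p)" by (simp add: cong_iff_dvd_diff)
    thus ?thesis using y assms cong_less_imp_eq_int[of x "int p" y] by auto
  next
    assume "int p dvd x + y"
    then obtain c where c: "x + y = int p * c" by auto
    have "0 < x + y" "x + y < 2 * int p" using y assms by auto
    hence "0 < int p * c" "int p * c < int p * 2" unfolding c by auto
    hence "c = 1" by (simp add: zero_less_mult_iff mult_less_cancel_left)
    thus ?thesis using c by auto
  qed
next
  fix y assume "y \<in> {x, int p - x}"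
  hence "y = x \<or> y = int p - x" by auto
  thus "y \<in> {y \<in> R. [x\<^sup>2 = y\<^sup>2] (mod int p)}"
  proof (rule disjE)
    assume "y = int p - x"
    moreover have "x\<^sup>2 - (int p - x)\<^sup>2 = int p * (2 * x - int p)"
      by (simp add: power2_eq_square algebra_simps)
    ultimately show ?thesis using assms by (simp add: cong_iff_dvd_diff)
  qed (use assms in auto)
qed

text \<open>After expanding the square, summing over k first leaves p times the pairs with x^2 =
  y^2, minus a product of two vanishing character sums.\<close>

lemma sum_jacobsthal_power2: "(\<Sum>k\<in>R. jacobsthal k ^ 2) = 2 * int p * (int p - 1)"
proof -
  have "(\<Sum>k\<in>R. jacobsthal k ^ 2)
      = (\<Sum>k\<in>R. \<Sum>x\<in>R. \<Sum>y\<in>R. \<phi> x * \<phi> y * (\<phi> (x\<^sup>2 - k) * \<phi> (y\<^sup>2 - k)))"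
    unfolding jacobsthal_def power2_eq_square sum_product
    by (intro sum.cong refl) (simp add: mult_ac)
  also have "\<dots> = (\<Sum>x\<in>R. \<Sum>k\<in>R. \<Sum>y\<in>R. \<phi> x * \<phi> y * (\<phi> (x\<^sup>2 - k) * \<phi> (y\<^sup>2 - k)))"
    by (rule sum.swap)
  also have "\<dots> = (\<Sum>x\<in>R. \<Sum>y\<in>R. \<phi> x * \<phi> y * (\<Sum>k\<in>R. \<phi> (x\<^sup>2 - k) * \<phi> (y\<^sup>2 - k)))"
    by (rule sum.cong[OF refl], subst sum.swap) (simp add: sum_distrib_left)
  also have "\<dots> = (\<Sum>x\<in>R. \<Sum>y\<in>R. int p * (\<phi> x * (if [x\<^sup>2 = y\<^sup>2] (mod int p) then \<phi> y else 0)) - \<phi> x * \<phi> y)"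
    unfolding sum_legendre_two_shifts by (intro sum.cong refl) (simp add: algebra_simps)
  also have "\<dots> = int p * (\<Sum>x\<in>R. \<phi> x * (\<Sum>y\<in>R. if [x\<^sup>2 = y\<^sup>2] (mod int p) then \<phi> y else 0))
      - (\<Sum>x\<in>R. \<phi> x) * (\<Sum>y\<in>R. \<phi> y)"
    unfolding sum_product by (simp add: sum_subtractf sum_distrib_left)
  also have "(\<Sum>x\<in>R. \<phi> x * (\<Sum>y\<in>R. if [x\<^sup>2 = y\<^sup>2] (mod int p) then \<phi> y else 0)) = (\<Sum>x\<in>R. 2 * \<phi> x ^ 2)"
  proof (intro sum.cong refl)
    fix x assume x: "x \<in> R"
    show "\<phi> x * (\<Sum>y\<in>R. if [x\<^sup>2 = y\<^sup>2] (mod int p) then \<phi> y else 0) = 2 * \<phi> x ^ 2"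
    proof (cases "x = 0")
      case True
      thus ?thesis using legendre_eq_0_iff[of 0] by simp
    next
      case False
      have "(\<Sum>y\<in>R. if [x\<^sup>2 = y\<^sup>2] (mod int p) then \<phi> y else 0) = (\<Sum>y\<in>{y \<in> R. [x\<^sup>2 = y\<^sup>2] (mod int p)}. \<phi> y)"
        by (rule sum.inter_filter[symmetric]) simp
      also have "\<dots> = \<phi> x + \<phi> (int p - x)"
        unfolding residues_with_square[OF x False] using odd_p by (subst sum.insert) (auto, presburger)
      \<comment> \<open>Here -1 is a residue, so y = x and y = -x reinforce each other instead of
        cancelling.\<close>
      also have "\<phi> (int p - x) = \<phi> x"
        using legendre_cong[of "int p - x" "- x"] legendre_minus by (simp add: cong_iff_dvd_diff)
      finally show ?thesis by (simp add: power2_eq_square)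
    qed
  qed
  also have "\<dots> = 2 * (int p - 1)" by (simp add: sum_distrib_left[symmetric] sum_legendre_power2)
  finally show ?thesis by (simp add: sum_legendre)
qed

text \<open>By scaling, S(k)^2 takes one value on nonzero residues and one on nonresidues, each
  class having (p-1)/2 elements; the second moment then determines the sum of the two
  values.\<close>

lemma jacobsthal_sum_of_squares:
  assumes "\<phi> \<nu> = -1"
  shows "jacobsthal 1 ^ 2 + jacobsthal \<nu> ^ 2 = 4 * int p"
proof -
  have \<nu>: "\<not> int p dvd \<nu>" using assms legendre_eq_0_iff[of \<nu>] by auto
  \<comment> \<open>A case distinction written as a polynomial in the symbol of k, so that it can be
    summed: the coefficients are (2, 0), (0, 2) or (0, 0).\<close>
  have *: "2 * jacobsthal k ^ 2 = (\<phi> k ^ 2 + \<phi> k) * jacobsthal 1 ^ 2 + (\<phi> k ^ 2 - \<phi> k) * jacobsthal \<nu> ^ 2"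
    for k
  proof -
    consider "\<phi> k = 0" | "\<phi> k = 1" | "\<phi> k = -1" using legendre_cases[of k] by auto
    thus ?thesis
    proof cases
      case 1
      hence "[k = 0] (mod int p)" by (simp add: legendre_eq_0_iff cong_0_iff)
      thus ?thesis using 1 jacobsthal_cong jacobsthal_0 by fastforce
    next
      case 2
      then obtain t where t: "[t\<^sup>2 = k] (mod int p)" "\<not> int p dvd t" by (rule legendre_eq_1D)
      have "jacobsthal k = \<phi> t * jacobsthal 1"
        using jacobsthal_cong[OF t(1)] jacobsthal_scale[OF t(2), of 1] by simp
      thus ?thesis using 2 legendre_power2[OF t(2)] by (simp add: power_mult_distrib)
    next
      case 3
      hence "\<phi> (k * \<nu>) = 1" using assms by (simp add: legendre_mult)
      then obtain t where t: "[t\<^sup>2 = k * \<nu>] (mod int p)" "\<not> int p dvd t" by (rule legendre_eq_1D)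
      \<comment> \<open>The number t^2 \<open>\<nu>\<close> = \<open>\<nu>\<close>^2 k can be scaled
        from \<open>\<nu>\<close> or from k, which relates S(k) to S(\<open>\<nu>\<close>) up to
        sign.\<close>
      have "[t\<^sup>2 * \<nu> = \<nu>\<^sup>2 * k] (mod int p)"
        using cong_scalar_right[OF t(1), of \<nu>] by (simp add: power2_eq_square mult_ac)
      hence "\<phi> t * jacobsthal \<nu> = \<phi> \<nu> * jacobsthal k"
        using jacobsthal_cong jacobsthal_scale[OF t(2)] jacobsthal_scale[OF \<nu>] by metis
      hence "(\<phi> t * jacobsthal \<nu>)\<^sup>2 = (\<phi> \<nu> * jacobsthal k)\<^sup>2" by simp
      thus ?thesis using 3 legendre_power2[OF t(2)] legendre_power2[OF \<nu>]
        by (simp add: power_mult_distrib)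
    qed
  qed
  have "2 * (2 * int p * (int p - 1)) = (\<Sum>k\<in>R. 2 * jacobsthal k ^ 2)"
    by (simp add: sum_distrib_left[symmetric] sum_jacobsthal_power2)
  also have "\<dots> = ((\<Sum>k\<in>R. \<phi> k ^ 2) + (\<Sum>k\<in>R. \<phi> k)) * jacobsthal 1 ^ 2 + ((\<Sum>k\<in>R. \<phi> k ^ 2) - (\<Sum>k\<in>R. \<phi> k)) * jacobsthal \<nu> ^ 2"
    unfolding * by (simp add: sum.distrib sum_subtractf sum_distrib_right[symmetric])
  also have "\<dots> = (int p - 1) * (jacobsthal 1 ^ 2 + jacobsthal \<nu> ^ 2)"
    by (simp add: sum_legendre sum_legendre_power2 algebra_simps)
  finally have "(int p - 1) * (jacobsthal 1 ^ 2 + jacobsthal \<nu> ^ 2) = (int p - 1) * (4 * int p)"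
    by (simp add: algebra_simps)
  thus ?thesis using p_gt_2 by simp
qed

section \<open>The residue of S(1) modulo 8\<close>

lemma jacobsthal_summand_square_cong:
  assumes "[x\<^sup>2 = y\<^sup>2] (mod int p)"
  shows "\<phi> x * \<phi> (x\<^sup>2 - 1) = \<phi> y * \<phi> (y\<^sup>2 - 1)"
proof -
  have "\<phi> x = \<phi> y"
    using cong_square_imp[OF assms] legendre_cong legendre_minus[of y] by metis
  moreover have "\<phi> (x\<^sup>2 - 1) = \<phi> (y\<^sup>2 - 1)"
    by (intro legendre_cong cong_diff assms cong_refl)
  ultimately show ?thesis by simp
qed

text \<open>If xz = 1 then x^2 (z^2 - 1) = 1 - x^2, where x^2 and -1 are residues; moreover x and z
  have the same symbol.\<close>

lemma jacobsthal_summand_inverse: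
  assumes "[x * z = 1] (mod int p)"
  shows "\<phi> z * \<phi> (z\<^sup>2 - 1) = \<phi> x * \<phi> (x\<^sup>2 - 1)"
proof -
  have 1: "\<phi> x * \<phi> z = 1" using legendre_cong[OF assms] by (simp add: legendre_mult)
  hence eq: "\<phi> z = \<phi> x" and sq: "\<phi> (x\<^sup>2) = 1"
    using legendre_cases[of x] legendre_cases[of z] by (auto simp: power2_eq_square legendre_mult)
  have "[(x * z)\<^sup>2 = 1\<^sup>2] (mod int p)" using assms by (rule cong_pow)
  hence "[x\<^sup>2 * (z\<^sup>2 - 1) = 1 - x\<^sup>2] (mod int p)"
    by (simp add: cong_iff_dvd_diff algebra_simps power_mult_distrib)
  hence "\<phi> (x\<^sup>2) * \<phi> (z\<^sup>2 - 1) = \<phi> (1 - x\<^sup>2)"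
    using legendre_cong by (simp add: legendre_mult[symmetric])
  also have "\<phi> (1 - x\<^sup>2) = \<phi> (x\<^sup>2 - 1)" using legendre_minus[of "x\<^sup>2 - 1"] by simp
  finally show ?thesis using eq sq by simp
qed

text \<open>The summands of \<open>jacobsthal 1\<close> are invariant under $x \mapsto -x$ and $x \mapsto 1/x$.
  All orbits of nonzero summands have four elements, except for the orbit of the square roots
  of $-1$, whose two summands are 1 because $x (x^2 - 1) = -2x = (1 - x)^2$ there.\<close>

lemma jacobsthal_1_mod_8: "[jacobsthal 1 = 4 * int m - 2] (mod 8)"
proof -
  define f where "f x = \<phi> x * \<phi> (x\<^sup>2 - 1)" for x
  have f_cases: "f x = 0 \<or> f x = 1 \<or> f x = -1" for x
    using legendre_cases[of x] legendre_cases[of "x\<^sup>2 - 1"] by (auto simp: f_def)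
  define N where "N = {x \<in> R. f x = 1}"
  have f0: "{x \<in> R. f x = 0} = {0, 1, int p - 1}"
  proof -
    have "f x = 0 \<longleftrightarrow> x = 0 \<or> x = 1 \<or> x = int p - 1" if x: "x \<in> R" for x
    proof -
      have "f x = 0 \<longleftrightarrow> int p dvd x \<or> [1\<^sup>2 = x\<^sup>2] (mod int p)"
        by (simp add: f_def legendre_eq_0_iff cong_iff_dvd_diff dvd_diff_commute)
      also have "[1\<^sup>2 = x\<^sup>2] (mod int p) \<longleftrightarrow> x \<in> {1, int p - 1}"
        using residues_with_square[of 1] x p_gt_2 by auto
      finally show ?thesis using residue_dvd_iff[OF x] by auto
    qed
    thus ?thesis using p_gt_2 by auto
  qed
  have "int (card {x \<in> R. f x = 0}) = 3"
    unfolding f0 using p_gt_2 by (auto simp: card_insert_if)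
  \<comment> \<open>For values in -1, 0, 1 the sum is determined by the number of ones and of
    zeros.\<close>
  moreover have "(\<Sum>x\<in>R. f x) = (\<Sum>x\<in>R. 2 * of_bool (f x = 1) + of_bool (f x = 0) - 1)"
    by (intro sum.cong refl) (use f_cases in fastforce)
  hence "jacobsthal 1 = 2 * int (card N) + int (card {x \<in> R. f x = 0}) - int p"
    by (simp add: jacobsthal_def f_def[symmetric] N_def sum.distrib sum_subtractf
          sum_distrib_left[symmetric] Int_def)
  ultimately have jac: "jacobsthal 1 = 2 * int (card N) - 4 * int m + 2"
    using p_eq by simp
  obtain t where t: "[t\<^sup>2 = -1] (mod int p)"
    using legendre_eq_1D[OF legendre_minus_one] by blast
  define I where "I = t mod int p"
  have I2: "[I\<^sup>2 = -1] (mod int p)" using t by (simp add: I_def cong_def power_mod)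
  have IR: "I \<in> R" by (simp add: I_def)
  have I0: "I \<noteq> 0" using I2 p_gt_2 by (auto simp: cong_iff_dvd_diff dest: zdvd_imp_le)
  have fI: "f x = 1" if "[I\<^sup>2 = x\<^sup>2] (mod int p)" for x
  proof -
    have x2: "[x\<^sup>2 = -1] (mod int p)" using that I2 cong_sym cong_trans by blast
    have "[x * (x\<^sup>2 - 1) = x * (-1 - 1)] (mod int p)"
      by (intro cong_scalar_left cong_diff x2 cong_refl)
    also have "[x * (-1 - 1) = 1 + x\<^sup>2 + x * (-1 - 1)] (mod int p)"
      using cong_add[OF cong_add[OF cong_refl[of 1] x2] cong_refl[of "x * (-1 - 1)"]]
      by (simp add: cong_sym_eq)
    also have "1 + x\<^sup>2 + x * (-1 - 1) = (1 - x)\<^sup>2" by (simp add: power2_eq_square algebra_simps)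
    finally have "f x = \<phi> ((1 - x)\<^sup>2)"
      unfolding f_def legendre_mult[symmetric] by (rule legendre_cong)
    moreover have "\<not> int p dvd 1 - x"
    proof
      assume "int p dvd 1 - x"
      hence "[x\<^sup>2 = 1\<^sup>2] (mod int p)" by (intro cong_pow) (simp add: cong_iff_dvd_diff dvd_diff_commute)
      hence "[-1 = 1] (mod int p)" using x2 by (simp add: cong_def)
      thus False using p_gt_2 by (auto simp: cong_iff_dvd_diff dest: zdvd_imp_le)
    qed
    ultimately show ?thesis using legendre_power2[of "1 - x"] by (simp add: power2_eq_square legendre_mult)
  qed
  define N0 where "N0 = N - {I, int p - I}"
  have N0_eq: "N0 = {x \<in> N. \<not> [x\<^sup>2 = -1] (mod int p)}"
  proof -
    have "[x\<^sup>2 = -1] (mod int p) \<longleftrightarrow> x \<in> {I, int p - I}" if x: "x \<in> R" for x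
    proof -
      have "[x\<^sup>2 = -1] (mod int p) \<longleftrightarrow> [I\<^sup>2 = x\<^sup>2] (mod int p)" using I2 by (auto simp: cong_def)
      thus ?thesis using residues_with_square[OF IR I0] x by auto
    qed
    thus ?thesis unfolding N0_def N_def by auto
  qed
  have sub: "{I, int p - I} \<subseteq> N"
    using residues_with_square[OF IR I0] fI unfolding N_def by blast
  have two: "card {x, int p - x} = 2" for x
  proof -
    have "x \<noteq> int p - x" using odd_p by presburger
    thus ?thesis by simp
  qed
  have fin: "finite N" unfolding N_def by (rule finite_subset[of _ R]) auto
  hence fin0: "finite N0" by (simp add: N0_def)
  have cardN: "card N = card N0 + 2"
    using card_Diff_subset[OF _ sub] card_mono[OF fin sub] two[of I] by (simp add: N0_def)
  \<comment> \<open>Expresses that y is one of x, -x, 1/x, -1/x by means of squares, without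
    choosing inverses.\<close>
  define r where "r = {(x, y). x \<in> N0 \<and> y \<in> N0 \<and>
     ([x\<^sup>2 = y\<^sup>2] (mod int p) \<or> [x\<^sup>2 * y\<^sup>2 = 1] (mod int p))}"
  have "equiv N0 r"
  proof (rule equivI)
    show "r \<subseteq> N0 \<times> N0" by (auto simp: r_def)
    show "refl_on N0 r" by (auto simp: refl_on_def r_def)
    show "sym r" by (auto simp: sym_def r_def cong_sym mult.commute)
    show "trans r"
    proof (rule transI)
      fix x y z assume xy: "(x, y) \<in> r" and yz: "(y, z) \<in> r"
      define a b c where "a = x\<^sup>2" and "b = y\<^sup>2" and "c = z\<^sup>2"
      have "[a = b] (mod int p) \<or> [a * b = 1] (mod int p)" "[b = c] (mod int p) \<or> [b * c = 1] (mod int p)"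
        using xy yz by (auto simp: r_def a_def b_def c_def)
      hence "[a = c] (mod int p) \<or> [a * c = 1] (mod int p)"
      proof (elim disjE)
        assume 1: "[a = b] (mod int p)" and 2: "[b = c] (mod int p)"
        thus ?thesis using cong_trans by blast
      next
        assume 1: "[a = b] (mod int p)" and 2: "[b * c = 1] (mod int p)"
        thus ?thesis using cong_trans[OF cong_scalar_right[OF 1, of c] 2] by blast
      next
        assume 1: "[a * b = 1] (mod int p)" and 2: "[b = c] (mod int p)"
        thus ?thesis using cong_trans[OF cong_scalar_left[OF cong_sym[OF 2], of a] 1] by blast
      next
        assume 1: "[a * b = 1] (mod int p)" and 2: "[b * c = 1] (mod int p)"
        have "[a * (b * c) = a * 1] (mod int p)" by (rule cong_scalar_left[OF 2])
        moreover have "[a * b * c = 1 * c] (mod int p)" by (rule cong_scalar_right[OF 1])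
        ultimately have "[a = c] (mod int p)" by (simp add: mult.assoc) (metis cong_sym cong_trans)
        thus ?thesis ..
      qed
      thus "(x, z) \<in> r" using xy yz by (auto simp: r_def a_def c_def)
    qed
  qed
  moreover have "4 dvd card X" if X: "X \<in> N0 // r" for X
  proof -
    obtain x where x: "x \<in> N0" and Xx: "X = r `` {x}" using X by (rule quotientE)
    have xR: "x \<in> R" and fx: "f x = 1" and xm1: "\<not> [x\<^sup>2 = -1] (mod int p)"
      using x by (auto simp: N0_eq N_def)
    have x0: "x \<noteq> 0" using fx legendre_eq_0_iff[of 0] by (auto simp: f_def)
    have x1: "\<not> [x\<^sup>2 = 1] (mod int p)"
      using fx legendre_eq_0_iff[of "x\<^sup>2 - 1"] by (auto simp: f_def cong_iff_dvd_diff)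
    have "coprime x (int p)"
      using residue_dvd_iff[OF xR] x0 prime_int_p by (metis coprime_commute prime_imp_coprime)
    then obtain z' where z': "[x * z' = 1] (mod int p)" using cong_solve_coprime_int by blast
    define z where "z = z' mod int p"
    have z: "[x * z = 1] (mod int p)" using z' by (simp add: z_def cong_def mod_mult_right_eq)
    have zR: "z \<in> R" by (simp add: z_def)
    have z0: "z \<noteq> 0" using z p_gt_2 by (auto simp: cong_iff_dvd_diff)
    have z2: "[x\<^sup>2 * z\<^sup>2 = 1] (mod int p)"
      using cong_pow[OF z, of 2] by (simp add: power_mult_distrib)
    have iff: "[x\<^sup>2 * y\<^sup>2 = 1] (mod int p) \<longleftrightarrow> [z\<^sup>2 = y\<^sup>2] (mod int p)" for y
    proof
      assume "[x\<^sup>2 * y\<^sup>2 = 1] (mod int p)"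
      hence "[x\<^sup>2 * z\<^sup>2 = x\<^sup>2 * y\<^sup>2] (mod int p)" using z2 by (simp add: cong_def)
      thus "[z\<^sup>2 = y\<^sup>2] (mod int p)"
        by (rule cong_cancel) (use residue_dvd_iff[OF xR] x0 prime_int_p in \<open>simp add: prime_dvd_power_iff\<close>)
    next
      assume "[z\<^sup>2 = y\<^sup>2] (mod int p)"
      from cong_scalar_left[OF this, of "x\<^sup>2"] show "[x\<^sup>2 * y\<^sup>2 = 1] (mod int p)"
        using z2 by (simp add: cong_def)
    qed
    have N0_closed: "y \<in> N0" if "w \<in> N0" "y \<in> R" "[w\<^sup>2 = y\<^sup>2] (mod int p)" for w y
    proof -
      have "f y = f w" unfolding f_def using jacobsthal_summand_square_cong[OF that(3)] by simp
      moreover have "\<not> [y\<^sup>2 = -1] (mod int p)"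
        using that by (auto simp: N0_eq) (metis cong_trans)
      ultimately show ?thesis using that by (auto simp: N0_eq N_def)
    qed
    have zN0: "z \<in> N0"
    proof -
      have "f z = 1" using jacobsthal_summand_inverse[OF z] fx by (simp add: f_def)
      moreover have "\<not> [z\<^sup>2 = -1] (mod int p)"
      proof
        assume "[z\<^sup>2 = -1] (mod int p)"
        from cong_scalar_left[OF this, of "x\<^sup>2"] have "[- (x\<^sup>2) = 1] (mod int p)"
          using z2 cong_sym cong_trans by (simp, blast)
        thus False using xm1 cong_minus_minus_iff[of "x\<^sup>2" "-1" "int p"] by simp
      qed
      ultimately show ?thesis using zR by (simp add: N0_eq N_def)
    qed
    have "X = {y \<in> R. [x\<^sup>2 = y\<^sup>2] (mod int p)} \<union> {y \<in> R. [z\<^sup>2 = y\<^sup>2] (mod int p)}"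
    proof -
      have "N0 \<subseteq> R" by (auto simp: N0_eq N_def)
      thus ?thesis unfolding Xx r_def using N0_closed[OF x] N0_closed[OF zN0] x iff by auto
    qed
    hence X4: "X = {x, int p - x} \<union> {z, int p - z}"
      unfolding residues_with_square[OF xR x0] residues_with_square[OF zR z0] .
    \<comment> \<open>A common element would give x^4 = 1, but x^2 = 1 makes the summand 0 and the
      roots of x^2 = -1 have been removed from \<open>N0\<close>.\<close>
    have "{y \<in> R. [x\<^sup>2 = y\<^sup>2] (mod int p)} \<inter> {y \<in> R. [z\<^sup>2 = y\<^sup>2] (mod int p)} = {}"
    proof (rule ccontr)
      assume "\<not> ?thesis"
      then obtain y where "[x\<^sup>2 = y\<^sup>2] (mod int p)" "[z\<^sup>2 = y\<^sup>2] (mod int p)" by blast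
      hence "[z\<^sup>2 = x\<^sup>2] (mod int p)" by (simp add: cong_def)
      hence "[x\<^sup>2 * x\<^sup>2 = 1] (mod int p)" by (rule iff[THEN iffD2])
      hence "[(x\<^sup>2)\<^sup>2 = 1\<^sup>2] (mod int p)" by (simp add: power2_eq_square)
      thus False using cong_square_imp x1 xm1 by blast
    qed
    hence "{x, int p - x} \<inter> {z, int p - z} = {}"
      unfolding residues_with_square[OF xR x0] residues_with_square[OF zR z0] .
    hence "card X = 4" unfolding X4 using two[of x] two[of z] by (subst card_Un_disjoint) auto
    thus ?thesis by simp
  qed
  ultimately have "4 dvd card N0" using equiv_imp_dvd_card[OF fin0] by blast
  then obtain c where "card N0 = 4 * c" by auto
  \<comment> \<open>With |\<open>N\<close>| = 4c + 2 the count gives S(1) = 8c + 6 - 4m.\<close>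
  hence "jacobsthal 1 - (4 * int m - 2) = 8 * (int c + 1 - int m)" using jac cardN by simp
  thus ?thesis unfolding cong_iff_dvd_diff by (rule dvdI)
qed

section \<open>The Jacobsthal sum modulo the square of p\<close>

lemma fermat: "\<not> int p dvd x \<Longrightarrow> [x ^ (4 * m) = 1] (mod int p)"
  using euler[of x] legendre_power2[of x] cong_pow[OF euler[of x], of 2]
  by (simp add: cong_sym_eq flip: power_mult)

lemma fermat_p: "[x ^ p = x] (mod int p)"
proof (cases "int p dvd x")
  case True
  thus ?thesis using p_eq by (simp add: cong_def mod_eq_0_iff_dvd power_add)
next
  case False
  from cong_scalar_left[OF fermat[OF this], of x] show ?thesis by (simp add: p_eq)
qed

abbreviation R' :: "int set" where "R' \<equiv> R - {0}"

text \<open>The powers $x^p$ are Teichmueller representatives modulo $p^2$; their power sums are those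
  of the group of $(p-1)$-st roots of unity.\<close>

lemma teichmueller_power_sum:
  "[(\<Sum>x\<in>R'. x ^ (p * M)) = (if 4 * m dvd M then int p - 1 else 0)] (mod (int p ^ 2))"
proof (cases "4 * m dvd M")
  case True
  then obtain c where c: "M = 4 * m * c" by auto
  have "[(\<Sum>x\<in>R'. x ^ (p * M)) = (\<Sum>x\<in>R'. 1)] (mod (int p ^ 2))"
  proof (rule cong_sum)
    fix x assume x: "x \<in> R'"
    hence "\<not> int p dvd x" using residue_dvd_iff[of x] by auto
    from cong_pow[OF fermat[OF this], of c] have "[x ^ M = 1] (mod int p)"
      by (simp add: c power_mult)
    from cong_power_lift[OF this] show "[x ^ (p * M) = 1] (mod (int p ^ 2))"
      by (simp add: mult.commute[of p] power_mult)
  qed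
  thus ?thesis using True by (simp add: card_Diff_singleton_if of_nat_diff Suc_leI)
next
  case False
  then obtain t where t: "\<not> int p dvd t" "\<not> [t ^ M = 1] (mod int p)"
    by (rule exists_power_incongruent_1)
  \<comment> \<open>Reduction modulo p^2 makes the power a function of the class of x modulo p, as
    reindexing demands; the value 0 on multiples of p lets the sums over \<open>R\<close> and
    \<open>R'\<close> agree.\<close>
  define g where "g x = (if int p dvd x then 0 else x ^ (p * M) mod (int p ^ 2))" for x
  have g: "[g x = x ^ (p * M)] (mod (int p ^ 2))" if "x \<in> R'" for x
    using that residue_dvd_iff[of x] by (simp add: g_def)
  have g_cong: "g x = g y" if "[x = y] (mod int p)" for x y
    using cong_power_lift[OF cong_pow[OF that, of M]] cong_dvd_iff[OF that]
    by (simp add: g_def cong_def mult.commute[of p] power_mult)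
  have sum_g: "(\<Sum>x\<in>R. g x) = (\<Sum>x\<in>R'. g x)"
    by (rule sum.mono_neutral_right) (auto simp: g_def)
  define W where "W = (\<Sum>x\<in>R'. x ^ (p * M))"
  have W: "[W = (\<Sum>x\<in>R. g x)] (mod (int p ^ 2))"
    unfolding W_def sum_g by (intro cong_sum cong_sym[OF g])
  have "(\<Sum>x\<in>R. g x) = (\<Sum>x\<in>R. g (t * x))"
    by (rule sum_residues_scale[symmetric]) (fact g_cong, fact t(1))
  also have "\<dots> = (\<Sum>x\<in>R'. g (t * x))"
    by (rule sum.mono_neutral_right) (auto simp: g_def)
  also have "[\<dots> = (\<Sum>x\<in>R'. t ^ (p * M) * x ^ (p * M))] (mod (int p ^ 2))"
  proof (rule cong_sum)
    fix x assume x: "x \<in> R'"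
    hence "\<not> int p dvd t * x" using residue_dvd_iff[of x] t prime_int_p by (auto simp: prime_dvd_mult_iff)
    thus "[g (t * x) = t ^ (p * M) * x ^ (p * M)] (mod (int p ^ 2))"
      by (simp add: g_def power_mult_distrib)
  qed
  also have "(\<Sum>x\<in>R'. t ^ (p * M) * x ^ (p * M)) = t ^ (p * M) * W"
    by (simp add: W_def sum_distrib_left)
  finally have "[W = t ^ (p * M) * W] (mod (int p ^ 2))" using W cong_trans by blast
  hence "int p ^ 2 dvd (t ^ (p * M) - 1) * W"
    by (simp add: cong_iff_dvd_diff dvd_diff_commute algebra_simps)
  \<comment> \<open>Non-congruence to 1 modulo p alone makes the factor t^(pM) - 1 invertible modulo
    p^2, so it can be cancelled.\<close>
  moreover have "coprime (int p ^ 2) (t ^ (p * M) - 1)"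
  proof -
    have tM: "[t ^ (p * M) = t ^ M] (mod int p)"
      using fermat_p[of "t ^ M"] by (simp add: mult.commute[of p] power_mult)
    have "\<not> int p dvd t ^ (p * M) - 1"
    proof
      assume "int p dvd t ^ (p * M) - 1"
      hence "[t ^ (p * M) = 1] (mod int p)" by (simp add: cong_iff_dvd_diff)
      thus False using cong_trans[OF cong_sym[OF tM]] t(2) by blast
    qed
    hence "coprime (int p) (t ^ (p * M) - 1)" using prime_int_p prime_imp_coprime by blast
    thus ?thesis by simp
  qed
  ultimately have "int p ^ 2 dvd W" by (simp add: coprime_dvd_mult_right_iff)
  thus ?thesis using False by (simp add: W_def cong_0_iff)
qed

text \<open>First-order Taylor expansion: all terms with b^2 carry p^2.\<close>

lemma pcong_add_p_mult_power:
  assumes "integral a" "integral b"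
  shows "pcong 2 ((a + of_nat p * b) ^ Suc k) (a ^ Suc k + of_nat p * (of_nat (Suc k) * a ^ k * b))"
proof (induction k)
  case 0
  then show ?case by simp
next
  case (Suc k)
  have "pcong 2 ((a + of_nat p * b) * (a + of_nat p * b) ^ Suc k) ((a + of_nat p * b) * (a ^ Suc k + of_nat p * (of_nat (Suc k) * a ^ k * b)))"
    using assms by (intro pcong_lmult Suc integral_add integral_mult integral_of_nat)
  moreover have "(a + of_nat p * b) * (a ^ Suc k + of_nat p * (of_nat (Suc k) * a ^ k * b))
     = a ^ Suc (Suc k) + of_nat p * (of_nat (Suc (Suc k)) * a ^ Suc k * b)
       + of_nat p ^ 2 * (of_nat (Suc k) * a ^ k * b\<^sup>2)"
    by (simp add: algebra_simps power2_eq_square)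
  moreover have "pcong 2 (a ^ Suc (Suc k) + of_nat p * (of_nat (Suc (Suc k)) * a ^ Suc k * b)
       + of_nat p ^ 2 * (of_nat (Suc k) * a ^ k * b\<^sup>2)) (a ^ Suc (Suc k) + of_nat p * (of_nat (Suc (Suc k)) * a ^ Suc k * b) + 0)"
    using assms by (intro pcong_add pcong_refl pcong_p_mult_0 integral_mult integral_of_nat integral_power)
  ultimately show ?case using pcong_trans by (simp del: of_nat_Suc)
qed

lemma legendre_power_p: "\<phi> x ^ p = \<phi> x"
  using legendre_cases[of x] odd_p by auto

text \<open>In the binomial expansion the end terms give 1 - v^p = 1 - v, and the middle
  coefficients are p (-1)^(i-1) / i. The correction is a truncated series of log(1 - v).\<close>

lemma pcong_one_minus_power_p:
  assumes "integral v" "pcong 2 (v ^ p) v"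
  shows "pcong 2 ((1 - v) ^ p) ((1 - v) + of_nat p * (- (\<Sum>i=1..4 * m. v ^ i / of_nat i)))"
proof -
  have "(1 - v) ^ p = (\<Sum>i\<le>p. of_nat (p choose i) * (- v) ^ i)"
    using binomial_ring[of "- v" 1 p] by simp
  also have "{..p} = insert 0 (insert p {1..4 * m})" using p_eq by auto
  also have "(\<Sum>i\<in>insert 0 (insert p {1..4 * m}). of_nat (p choose i) * (- v) ^ i)
      = 1 - v ^ p + (\<Sum>i=1..4 * m. of_nat (p choose i) * (- v) ^ i)"
    using p_eq odd_p by (simp add: power_minus_odd)
  also have "pcong 2 \<dots> ((1 - v) + (\<Sum>i=1..4 * m. of_nat p * (- (v ^ i / of_nat i))))"
  proof (intro pcong_add pcong_sum pcong_diff pcong_refl assms)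
    fix i assume i: "i \<in> {1..4 * m}"
    then obtain l where l: "i = Suc l" by (cases i) auto
    have "pcong 2 ((- v) ^ i * of_nat (p choose i)) ((- v) ^ i * (of_nat p * ((-1) ^ (i - 1) / of_nat i)))"
      using assms i p_eq by (intro pcong_lmult pcong_binomial_prime integral_power integral_minus) auto
    moreover have "(- v) ^ i * (of_nat p * ((-1) ^ (i - 1) / of_nat i)) = of_nat p * (- (v ^ i / of_nat i))"
      unfolding power_minus[of v] l by (simp add: field_simps del: of_nat_Suc flip: power_mult_distrib)
    ultimately show "pcong 2 (of_nat (p choose i) * (- v) ^ i) (of_nat p * (- (v ^ i / of_nat i)))"
      by (simp add: mult.commute)
  qed
  finally show ?thesis by (simp add: sum_distrib_left sum_negf)
qed

text \<open>Both symbols are replaced by p-th powers of Euler's expressions in w = x^p and v = w^2.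
  Then (1 - v)^p is linearised in p, its 2m-th power is taken to first order, and everything is
  expanded in powers of w.\<close>

lemma pcong_jacobsthal_summand:
  fixes x :: int
  defines "w \<equiv> rat_of_int x ^ p"
  shows "pcong 2 (of_int (\<phi> x * \<phi> (x\<^sup>2 - 1)))
    ((\<Sum>j\<le>2 * m. (-1) ^ j * of_nat (2 * m choose j) * w ^ (2 * m + 2 * j))
     + of_nat p * (\<Sum>j<2 * m. \<Sum>i=1..4 * m. (-1) ^ j * of_nat ((2 * m - 1) choose j) / of_nat (2 * i) * w ^ (2 * m + 2 * (j + i))))"
proof -
  define v where "v = w ^ 2"
  define V where "V = (x ^ p) ^ 2"
  have vV: "v = of_int V" by (simp add: v_def V_def w_def)
  have iv: "integral v" and iw: "integral w" unfolding v_def w_def by auto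
  define n where "n = 2 * m - 1"
  have n: "2 * m = Suc n" using m_pos by (simp add: n_def)
  have "[V ^ p = V] (mod (int p ^ 2))"
    using cong_power_lift[OF fermat_p[of "x ^ 2"]] by (simp add: V_def flip: power_mult) (simp add: mult_ac)
  from pcong_of_int[OF this] have vp: "pcong 2 (v ^ p) v" by (simp add: vV)
  \<comment> \<open>Exchanging x^2 for (x^p)^2 inside the symbol makes the base satisfy v^p = v
    modulo p^2.\<close>
  have "[1 - V = 1 - x\<^sup>2] (mod int p)" unfolding V_def by (intro cong_diff cong_refl cong_pow fermat_p)
  hence "\<phi> (x\<^sup>2 - 1) = \<phi> (1 - V)"
    using legendre_cong[of "1 - V" "1 - x\<^sup>2"] legendre_minus[of "x\<^sup>2 - 1"] by simp
  also have "[\<phi> (1 - V) ^ p = ((1 - V) ^ (2 * m)) ^ p] (mod (int p ^ 2))"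
    by (rule cong_power_lift[OF euler])
  finally have "[\<phi> (x\<^sup>2 - 1) = ((1 - V) ^ p) ^ (2 * m)] (mod (int p ^ 2))"
    unfolding legendre_power_p by (simp add: mult.commute flip: power_mult)
  from pcong_of_int[OF this] have 1: "pcong 2 (of_int (\<phi> (x\<^sup>2 - 1))) (((1 - v) ^ p) ^ (2 * m))"
    by (simp add: vV)
  have "[\<phi> x ^ p = (x ^ (2 * m)) ^ p] (mod (int p ^ 2))"
    by (rule cong_power_lift[OF euler])
  hence "[\<phi> x = (x ^ p) ^ (2 * m)] (mod (int p ^ 2))"
    unfolding legendre_power_p by (simp add: mult.commute flip: power_mult)
  from pcong_of_int[OF this] have 2: "pcong 2 (of_int (\<phi> x)) (w ^ (2 * m))"
    by (simp add: w_def)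
  define B where "B = - (\<Sum>i=1..4 * m. v ^ i / of_nat i)"
  have nd: "\<not> p dvd i" if "i \<in> {1..4 * m}" for i using that p_eq by (intro not_dvd_less) auto
  have iB: "integral B" unfolding B_def
    by (intro integral_minus integral_sum integral_divide_nat integral_power iv nd)
  have pow: "pcong 2 (a ^ k) (b ^ k)" if "pcong 2 a b" "integral b" for a b k
    using that
  proof (induction k)
    case (Suc k)
    thus ?case using pcong_integral[of 2 a b]
      by (simp add: integral_power pcong_mult)
  qed simp
  have "pcong 2 (((1 - v) ^ p) ^ (2 * m)) (((1 - v) + of_nat p * B) ^ (2 * m))"
    using iv iB unfolding B_def
    by (intro pow pcong_one_minus_power_p vp integral_add integral_diff integral_mult integral_of_nat integral_1)
  also have "pcong 2 (((1 - v) + of_nat p * B) ^ (2 * m)) ((1 - v) ^ (2 * m) + of_nat p * (of_nat (2 * m) * (1 - v) ^ n * B))"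
    unfolding n using iv iB by (intro pcong_add_p_mult_power integral_diff integral_1)
  \<comment> \<open>The derivative factor 2m is -1/2 modulo p.\<close>
  also have "pcong 2 \<dots> ((1 - v) ^ (2 * m) + of_nat p * ((1 - v) ^ n * (- B / 2)))"
  proof (intro pcong_add pcong_refl pcong_p_mult)
    have "pcong 1 (of_nat (4 * m)) (-1)" by (rule pcong_sym[OF pcong_minus_1])
    hence "pcong 1 (of_nat (4 * m) / of_nat 2) (-1 / of_nat 2)"
      using p_gt_2 by (intro pcong_divide_nat not_dvd_less) auto
    hence "pcong 1 ((1 - v) ^ n * B * (of_nat (4 * m) / of_nat 2)) ((1 - v) ^ n * B * (-1 / of_nat 2))"
      using iv iB by (intro pcong_lmult integral_mult integral_power integral_diff integral_1)
    thus "pcong 1 (of_nat (2 * m) * (1 - v) ^ n * B) ((1 - v) ^ n * (- B / 2))"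
      by (simp add: field_simps)
  qed
  finally have "pcong 2 (of_int (\<phi> (x\<^sup>2 - 1))) ((1 - v) ^ (2 * m) + of_nat p * ((1 - v) ^ n * (- B / 2)))"
    using 1 pcong_trans by blast
  note 3 = this
  have "pcong 2 (of_int (\<phi> x) * of_int (\<phi> (x\<^sup>2 - 1))) (w ^ (2 * m) * ((1 - v) ^ (2 * m) + of_nat p * ((1 - v) ^ n * (- B / 2))))"
    by (rule pcong_mult[OF 2 3 integral_of_int pcong_integral[OF pcong_sym[OF 3] integral_of_int]])
  moreover have vj: "v ^ j = w ^ (2 * j)" for j by (simp only: v_def power_mult)
  moreover have bin: "(1 - v) ^ k = (\<Sum>j\<le>k. (-1) ^ j * of_nat (k choose j) * v ^ j)" for k
    using binomial_ring[of "- v" 1 k] by (simp add: power_minus[of v] mult_ac)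
  have "w ^ (2 * m) * ((1 - v) ^ (2 * m) + of_nat p * ((1 - v) ^ n * (- B / 2)))
     = ((\<Sum>j\<le>2 * m. (-1) ^ j * of_nat (2 * m choose j) * w ^ (2 * m + 2 * j))
     + of_nat p * (\<Sum>j<2 * m. \<Sum>i=1..4 * m. (-1) ^ j * of_nat ((2 * m - 1) choose j) / of_nat (2 * i) * w ^ (2 * m + 2 * (j + i))))"
  proof -
    have "w ^ (2 * m) * (1 - v) ^ (2 * m) = (\<Sum>j\<le>2 * m. (-1) ^ j * of_nat (2 * m choose j) * w ^ (2 * m + 2 * j))"
      unfolding bin vj by (simp add: sum_distrib_left power_add mult_ac)
    moreover have "w ^ (2 * m) * ((1 - v) ^ n * (- B / 2)) = (\<Sum>j<2 * m. \<Sum>i=1..4 * m. (-1) ^ j * of_nat ((2 * m - 1) choose j) / of_nat (2 * i) * w ^ (2 * m + 2 * (j + i)))"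
    proof -
      have lt: "{..<2 * m} = {..n}" using n by auto
      have B2: "- B / 2 = (\<Sum>i=1..4 * m. v ^ i / of_nat (2 * i))"
        by (simp add: B_def sum_divide_distrib mult.commute)
      show ?thesis
        unfolding bin n_def[symmetric] vj lt B2 sum_product unfolding sum_distrib_left
        by (simp add: power_add mult_ac)
    qed
    ultimately show ?thesis
      by (simp only: distrib_left mult.left_commute[of "w ^ (2 * m)" "of_nat p"])
  qed
  ultimately show ?thesis by simp
qed

section \<open>The terms of order p in S(1)\<close>

text \<open>The coefficients of (1 - v)^(2m-1).\<close>

definition c :: "nat \<Rightarrow> rat" where
  "c j = (-1) ^ j * of_nat ((2 * m - 1) choose j)"

definition V :: rat where
  "V = (\<Sum>j<m. c j / of_nat (m - j))"

lemma integral_c [simp]: "integral (c j)"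
  unfolding c_def by (intro integral_mult integral_sign integral_of_nat)

text \<open>Selects the exponents whose power sum survives. For e = j + i with j < 2m and i at most
  4m the bound holds, and only the multiples 4m, 8m, 12m are possible.\<close>

lemma dvd_4m_iff:
  assumes "e < 6 * m"
  shows "4 * m dvd 2 * m + 2 * e \<longleftrightarrow> e = m \<or> e = 3 * m \<or> e = 5 * m"
proof
  assume "4 * m dvd 2 * m + 2 * e"
  then obtain k where k: "2 * m + 2 * e = 4 * m * k" by auto
  have "4 * m * k < 4 * m * 4" using assms k by linarith
  hence "k < 4" by simp
  moreover have "k \<noteq> 0" using k m_pos by (cases k) auto
  ultimately have "k = 1 \<or> k = 2 \<or> k = 3" by auto
  thus "e = m \<or> e = 3 * m \<or> e = 5 * m" using k by auto
next
  assume "e = m \<or> e = 3 * m \<or> e = 5 * m"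
  hence "2 * m + 2 * e = 4 * m * 1 \<or> 2 * m + 2 * e = 4 * m * 2 \<or> 2 * m + 2 * e = 4 * m * 3" by auto
  thus "4 * m dvd 2 * m + 2 * e" by (metis dvd_triv_left)
qed

text \<open>(2m-1 choose j) = (2m-j)/(2m) (2m choose j), and (2m-j)/(2m(m-j)) = 1/(2(m-j)) + 1/(2m).
  The second part leaves a truncated alternating row of binomial coefficients, which has a closed
  form.\<close>

lemma V_eq: "V = U / 2 - (-1) ^ m * of_nat (2 * m choose m) / of_nat (4 * m)"
proof -
  obtain n where n: "m = Suc n" using m_pos by (cases m) auto
  have c: "c j / of_nat (m - j) = ((-1) ^ j * of_nat (2 * m choose j)) / of_nat (m - j) / 2
     + (-1) ^ j * of_nat (2 * m choose j) / of_nat (2 * m)" if j: "j < m" for j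
  proof -
    have "(of_nat (2 * m) - of_nat j) * (of_nat (2 * m) gchoose j) = of_nat (2 * m) * ((of_nat (2 * m) - 1 :: rat) gchoose j)"
      by (rule gbinomial_absorb_comp)
    moreover have "(of_nat (2 * m) - 1 :: rat) = of_nat (2 * m - 1)" using n by simp
    ultimately have "(of_nat (2 * m) - of_nat j) * of_nat (2 * m choose j) = (of_nat (2 * m) * of_nat (2 * m - 1 choose j) :: rat)"
      by (simp only: binomial_gbinomial)
    hence B: "of_nat (2 * m - 1 choose j) = ((2 * of_nat m - of_nat j) * of_nat (2 * m choose j) / (2 * of_nat m) :: rat)"
      by (simp add: field_simps)
    have d: "of_nat (m - j) = (of_nat m - of_nat j :: rat)" using j by (simp add: of_nat_diff)
    have "s * ((2 * M - J) * B / (2 * M)) / (M - J) = s * B / (M - J) / 2 + s * B / (2 * M)"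
      if "M \<noteq> 0" "M - J \<noteq> 0" for s M J B :: rat
      using that by (simp add: field_simps)
    from this[of "of_nat m" "of_nat j"] show ?thesis unfolding c_def B d using j by simp
  qed
  have "V = U / 2 + (\<Sum>j<m. (-1) ^ j * of_nat (2 * m choose j)) / of_nat (2 * m)"
    unfolding V_def U_def using c by (simp add: sum.distrib sum_divide_distrib)
  also have "(\<Sum>j<m. (-1) ^ j * of_nat (2 * m choose j)) = (\<Sum>j\<le>n. (of_nat (2 * m) gchoose j) * (-1 :: rat) ^ j)"
    by (simp add: n lessThan_Suc_atMost binomial_gbinomial mult.commute)
  also have "\<dots> = (-1) ^ n * ((of_nat (2 * m) - 1) gchoose n)" by (rule gbinomial_sum_lower_neg)
  also have "(of_nat (2 * m) - 1 :: rat) = of_nat (2 * m - 1)" using n by simp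
  also have "(of_nat (2 * m - 1) :: rat) gchoose n = of_nat (2 * m choose m) / 2"
  proof -
    have "m * (2 * m choose m) = 2 * m * (2 * m - 1 choose n)"
      using Suc_times_binomial_eq[of "2 * m - 1" n] n by (simp add: mult.commute)
    hence "(2 * m choose m) = 2 * (2 * m - 1 choose n)" using m_pos by simp
    thus ?thesis by (simp only: binomial_gbinomial[symmetric] of_nat_mult)
  qed
  also have "(-1 :: rat) ^ n = - ((-1) ^ m)" by (simp add: n)
  finally show ?thesis by simp
qed

lemma pcong_V: "pcong 1 V (U / 2 + (-1) ^ m * of_nat (2 * m choose m))"
proof -
  have nd: "\<not> p dvd 4 * m" using p_eq m_pos by (intro not_dvd_less) auto
  have "pcong 1 (- 1 / of_nat (4 * m)) (of_nat (4 * m) / of_nat (4 * m))"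
    by (rule pcong_divide_nat[OF pcong_minus_1 nd])
  hence "pcong 1 ((-1) ^ m * of_nat (2 * m choose m) * (- 1 / of_nat (4 * m))) ((-1) ^ m * of_nat (2 * m choose m) * (of_nat (4 * m) / of_nat (4 * m)))"
    by (intro pcong_lmult integral_mult integral_sign integral_of_nat)
  from pcong_add[OF pcong_refl[of 1 "U / 2"] this] show ?thesis
    unfolding V_eq by simp
qed

text \<open>The reflection of j to 2m-1-j changes the sign of \<open>c\<close>, the degree 2m-1
  being odd, and turns the denominator into p - (m-j), which supplies a second sign.\<close>

lemma pcong_upper_half: "pcong 1 (\<Sum>j=m..<2 * m. c j / of_nat (5 * m - j)) V"
proof -
  have "(\<Sum>j=m..<2 * m. c j / of_nat (5 * m - j)) = (\<Sum>j<m. c (2 * m - 1 - j) / of_nat (5 * m - (2 * m - 1 - j)))"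
    by (rule sum.reindex_bij_witness[of _ "\<lambda>j. 2 * m - 1 - j" "\<lambda>j. 2 * m - 1 - j"]) auto
  also have "pcong 1 \<dots> V"
    unfolding V_def
  proof (rule pcong_sum)
    fix j assume "j \<in> {..<m}"
    hence j: "j < m" by simp
    have "c (2 * m - 1 - j) = - c j"
    proof -
      have "(-1 :: rat) ^ (2 * m - 1 - j) * (-1) ^ j = (-1) ^ (2 * m - 1)"
        using j by (simp flip: power_add)
      also have "\<dots> = -1" using m_pos by (cases m) auto
      finally have "(-1 :: rat) ^ (2 * m - 1 - j) = - ((-1) ^ j)"
        by (cases "even j") auto
      moreover have "(2 * m - 1 choose (2 * m - 1 - j)) = (2 * m - 1 choose j)"
        using j by (intro binomial_symmetric[symmetric]) auto
      ultimately show ?thesis by (simp add: c_def)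
    qed
    moreover have "5 * m - (2 * m - 1 - j) = 3 * m + 1 + j" using j by simp
    moreover have "pcong 1 (- c j / of_nat (3 * m + 1 + j)) (c j / of_nat (m - j))"
    proof -
      define q r where "q = m - j" and "r = 3 * m + 1 + j"
      have qr: "q > 0" "r > 0" "q < p" "r < p" "q + r = p" using j p_eq by (auto simp: q_def r_def)
      hence nd: "\<not> p dvd q * r" using prime_p not_dvd_less[of q] not_dvd_less[of r]
        by (simp add: prime_dvd_mult_iff)
      have "- c j / of_nat r - c j / of_nat q = of_nat p * (- c j / of_nat (q * r))"
        using qr(1,2) by (simp add: field_simps flip: qr(5))
      moreover have "integral (- c j / of_nat (q * r))"
        by (intro integral_divide_nat integral_minus nd integral_c)
      ultimately show ?thesis unfolding pcong_def q_def[symmetric] r_def[symmetric] by simp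
    qed
    ultimately show "pcong 1 (c (2 * m - 1 - j) / of_nat (5 * m - (2 * m - 1 - j))) (c j / of_nat (m - j))"
      by simp
  qed
  finally show ?thesis .
qed

text \<open>For fixed j exactly two i in the range make j + i one of m, 3m, 5m: always i = 3m - j,
  and m - j or 5m - j according to the size of j. The weight -1 is the power sum p - 1 modulo
  p.\<close>

lemma sum_reciprocals_eq:
  assumes "j < 2 * m"
  shows "(\<Sum>i=1..4 * m. 1 / of_nat (2 * i) * (if 4 * m dvd 2 * m + 2 * (j + i) then -1 else 0))
    = - ((if j < m then 1 / of_nat (m - j) else 1 / of_nat (5 * m - j)) + 1 / of_nat (3 * m - j)) / (2 :: rat)"
proof -
  define s where "s = (if j < m then m - j else 5 * m - j)"
  have "(\<Sum>i=1..4 * m. 1 / of_nat (2 * i) * (if 4 * m dvd 2 * m + 2 * (j + i) then -1 else 0))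
      = (\<Sum>i\<in>{s, 3 * m - j}. - 1 / of_nat (2 * i) :: rat)"
  proof (rule sum.mono_neutral_cong_right)
    show "{s, 3 * m - j} \<subseteq> {1..4 * m}" using assms by (auto simp: s_def)
    show "\<forall>i\<in>{1..4 * m} - {s, 3 * m - j}. 1 / of_nat (2 * i) * (if 4 * m dvd 2 * m + 2 * (j + i) then - 1 else 0) = (0 :: rat)"
    proof
      fix i assume i: "i \<in> {1..4 * m} - {s, 3 * m - j}"
      hence "\<not> 4 * m dvd 2 * m + 2 * (j + i)"
        using assms by (subst dvd_4m_iff) (auto simp: s_def split: if_splits)
      thus "1 / of_nat (2 * i) * (if 4 * m dvd 2 * m + 2 * (j + i) then - 1 else 0) = (0 :: rat)" by simp
    qed
    fix i assume i: "i \<in> {s, 3 * m - j}"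
    hence "4 * m dvd 2 * m + 2 * (j + i)"
      using assms by (subst dvd_4m_iff) (auto simp: s_def split: if_splits)
    thus "1 / of_nat (2 * i) * (if 4 * m dvd 2 * m + 2 * (j + i) then - 1 else 0) = (- 1 / of_nat (2 * i) :: rat)" by simp
  qed simp
  also have "s \<noteq> 3 * m - j" using assms by (auto simp: s_def)
  hence "(\<Sum>i\<in>{s, 3 * m - j}. - 1 / of_nat (2 * i) :: rat) = - 1 / of_nat (2 * s) + - 1 / of_nat (2 * (3 * m - j))"
    by simp
  finally show ?thesis by (simp add: s_def add_divide_distrib)
qed

text \<open>Among the first-order terms, j + i = m gives \<open>V\<close>, j + i = 5m gives
  \<open>H\<close>, congruent to \<open>V\<close>, and j + i = 3m gives \<open>Z\<close>. The first
  two together reproduce the \<open>U\<close> of D, leaving only \<open>Z\<close>.\<close>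

lemma pcong_jacobsthal_1: "pcong 2 (of_int (jacobsthal 1)) (- delannoy - of_nat p * (Z / 2))"
proof -
  define C where "C = (-1) ^ m * (of_nat (2 * m choose m) :: rat)"
  define H where "H = (\<Sum>j=m..<2 * m. c j / of_nat (5 * m - j))"
  define W where "W M = (\<Sum>x\<in>R'. (rat_of_int x ^ p) ^ M)" for M
  define e where "e M = (if 4 * m dvd M then of_nat p - 1 else 0 :: rat)" for M
  have W: "pcong 2 (W M) (e M)" for M
    using pcong_of_int[OF teichmueller_power_sum[of M]]
    by (simp add: W_def e_def power_mult if_distrib cong: if_cong split: if_splits)
  define a where "a j = (-1) ^ j * (of_nat (2 * m choose j) :: rat)" for j
  have ia: "integral (a j)" for j unfolding a_def by (intro integral_mult integral_sign integral_of_nat)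
  have "jacobsthal 1 = (\<Sum>x\<in>R'. \<phi> x * \<phi> (x\<^sup>2 - 1))"
    unfolding jacobsthal_def using legendre_eq_0_iff[of 0] by (intro sum.mono_neutral_right) auto
  hence jac: "rat_of_int (jacobsthal 1) = (\<Sum>x\<in>R'. of_int (\<phi> x * \<phi> (x\<^sup>2 - 1)))" by simp
  define F where "F x = (\<Sum>j\<le>2 * m. a j * (rat_of_int x ^ p) ^ (2 * m + 2 * j))" for x
  define G where "G x = (\<Sum>j<2 * m. \<Sum>i=1..4 * m. c j / of_nat (2 * i) * (rat_of_int x ^ p) ^ (2 * m + 2 * (j + i)))" for x
  have "pcong 2 (of_int (\<phi> x * \<phi> (x\<^sup>2 - 1))) (F x + of_nat p * G x)" for x
    unfolding F_def G_def a_def c_def by (rule pcong_jacobsthal_summand)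
  hence "pcong 2 (of_int (jacobsthal 1)) (\<Sum>x\<in>R'. F x + of_nat p * G x)"
    unfolding jac by (rule pcong_sum)
  also have "(\<Sum>x\<in>R'. F x + of_nat p * G x) = (\<Sum>x\<in>R'. F x) + of_nat p * (\<Sum>x\<in>R'. G x)"
    by (simp add: sum.distrib sum_distrib_left)
  also have "(\<Sum>x\<in>R'. F x) = (\<Sum>j\<le>2 * m. a j * W (2 * m + 2 * j))"
    unfolding F_def W_def sum_distrib_left by (rule sum.swap)
  also have "(\<Sum>x\<in>R'. G x) = (\<Sum>j<2 * m. \<Sum>i=1..4 * m. c j / of_nat (2 * i) * W (2 * m + 2 * (j + i)))"
    unfolding G_def W_def sum_distrib_left by (subst sum.swap, rule sum.cong[OF refl], rule sum.swap)
  also have "pcong 2 ((\<Sum>j\<le>2 * m. a j * W (2 * m + 2 * j))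
     + of_nat p * (\<Sum>j<2 * m. \<Sum>i=1..4 * m. c j / of_nat (2 * i) * W (2 * m + 2 * (j + i))))
     ((\<Sum>j\<le>2 * m. a j * e (2 * m + 2 * j))
     + of_nat p * (\<Sum>j<2 * m. \<Sum>i=1..4 * m. c j / of_nat (2 * i) * (if 4 * m dvd 2 * m + 2 * (j + i) then -1 else 0)))"
  proof (rule pcong_add[OF pcong_sum[OF pcong_lmult[OF ia W]] pcong_p_mult], intro pcong_sum pcong_lmult)
    fix i assume "i \<in> {1..4 * m}"
    hence "\<not> p dvd 2 * i" using p_eq p_gt_2 prime_p not_dvd_less[of i] not_dvd_less[of 2]
      by (auto simp: prime_dvd_mult_iff)
    thus "integral (c j / of_nat (2 * i))" for j by (intro integral_divide_nat integral_c)
    fix j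
    have "pcong 1 (W M) (e M)" for M by (rule pcong_weaken[OF W]) simp
    moreover have "pcong 1 (e M) (if 4 * m dvd M then -1 else 0)" for M
      by (simp add: e_def pcong_def)
    ultimately show "pcong 1 (W (2 * m + 2 * (j + i))) (if 4 * m dvd 2 * m + 2 * (j + i) then -1 else 0)"
      by (rule pcong_trans)
  qed
  \<comment> \<open>In the main part j is at most 2m, so j = m is the only surviving
    exponent.\<close>
  also have "(\<Sum>j\<le>2 * m. a j * e (2 * m + 2 * j)) = C * (of_nat p - 1)"
  proof -
    have "(\<Sum>j\<le>2 * m. a j * e (2 * m + 2 * j)) = (\<Sum>j\<in>{m}. a j * e (2 * m + 2 * j))"
    proof (rule sum.mono_neutral_right)
      show "\<forall>j\<in>{..2 * m} - {m}. a j * e (2 * m + 2 * j) = 0"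
      proof
        fix j assume j: "j \<in> {..2 * m} - {m}"
        hence "j < 6 * m" "j \<noteq> m" "j \<noteq> 3 * m" "j \<noteq> 5 * m" using m_pos by auto
        thus "a j * e (2 * m + 2 * j) = 0" unfolding e_def by (simp only: dvd_4m_iff) simp
      qed
    qed auto
    also have "4 * m dvd 2 * m + 2 * m" by simp
    hence "(\<Sum>j\<in>{m}. a j * e (2 * m + 2 * j)) = C * (of_nat p - 1)" by (simp add: e_def C_def a_def)
    finally show ?thesis .
  qed
  also have "(\<Sum>j<2 * m. \<Sum>i=1..4 * m. c j / of_nat (2 * i) * (if 4 * m dvd 2 * m + 2 * (j + i) then -1 else 0))
     = - (V + H + Z) / 2"
  proof -
    have "(\<Sum>j<2 * m. \<Sum>i=1..4 * m. c j / of_nat (2 * i) * (if 4 * m dvd 2 * m + 2 * (j + i) then -1 else 0))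
      = (\<Sum>j<2 * m. c j * (\<Sum>i=1..4 * m. 1 / of_nat (2 * i) * (if 4 * m dvd 2 * m + 2 * (j + i) then -1 else 0)))"
      by (simp add: sum_distrib_left)
    also have "\<dots> = (\<Sum>j<2 * m. - ((if j < m then c j / of_nat (m - j) else c j / of_nat (5 * m - j)) + c j / of_nat (3 * m - j)) / 2)"
    proof (rule sum.cong[OF refl])
      fix j assume "j \<in> {..<2 * m}"
      hence j: "j < 2 * m" by simp
      show "c j * (\<Sum>i=1..4 * m. 1 / of_nat (2 * i) * (if 4 * m dvd 2 * m + 2 * (j + i) then -1 else 0))
        = - ((if j < m then c j / of_nat (m - j) else c j / of_nat (5 * m - j)) + c j / of_nat (3 * m - j)) / 2"
        unfolding sum_reciprocals_eq[OF j] by (cases "j < m") (simp_all add: distrib_left right_diff_distrib)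
    qed
    also have "\<dots> = - ((\<Sum>j<2 * m. if j < m then c j / of_nat (m - j) else c j / of_nat (5 * m - j)) + Z) / 2"
      unfolding Z_def c_def[symmetric] by (simp only: sum.distrib sum_divide_distrib[symmetric] sum_negf)
    also have "(\<Sum>j<2 * m. if j < m then c j / of_nat (m - j) else c j / of_nat (5 * m - j)) = V + H"
    proof -
      have "{..<2 * m} = {..<m} \<union> {m..<2 * m}" by auto
      thus ?thesis by (simp add: V_def H_def sum.union_disjoint ivl_disj_int)
    qed
    finally show ?thesis .
  qed
  finally have "pcong 2 (of_int (jacobsthal 1)) (C * (of_nat p - 1) + of_nat p * (- (V + H + Z) / 2))" .
  also have "pcong 2 (C * (of_nat p - 1) + of_nat p * (- (V + H + Z) / 2)) (C * (of_nat p - 1) + of_nat p * (- (U / 2 + C) - Z / 2))"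
  proof (intro pcong_add pcong_refl pcong_p_mult)
    have V: "pcong 1 V (U / 2 + C)" using pcong_V by (simp add: C_def)
    hence "pcong 1 (V + H + Z) ((U / 2 + C) + (U / 2 + C) + Z)"
      using pcong_trans[OF pcong_upper_half[folded H_def] V] by (intro pcong_add pcong_refl)
    hence "pcong 1 (- (V + H + Z) / of_nat 2) (- ((U / 2 + C) + (U / 2 + C) + Z) / of_nat 2)"
      using p_gt_2 by (intro pcong_divide_nat pcong_minus not_dvd_less) auto
    moreover have "- ((U / 2 + C) + (U / 2 + C) + Z) / of_nat 2 = - (U / 2 + C) - Z / 2" by (simp add: field_simps)
    ultimately show "pcong 1 (- (V + H + Z) / 2) (- (U / 2 + C) - Z / 2)"
      by (simp only: of_nat_numeral)
  qed
  \<comment> \<open>The p C from the exact power sum p - 1 cancels against the p C contributed by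
    \<open>V\<close> and \<open>H\<close>.\<close>
  also have "C * (of_nat p - 1) + of_nat p * (- (U / 2 + C) - Z / 2) = - (C + of_nat p * (U / 2)) - of_nat p * (Z / 2)"
    by (simp add: algebra_simps)
  also have "pcong 2 (- (C + of_nat p * (U / 2)) - of_nat p * (Z / 2)) (- delannoy - of_nat p * (Z / 2))"
    unfolding C_def by (intro pcong_diff pcong_minus pcong_refl pcong_sym[OF pcong_delannoy])
  finally show ?thesis .
qed

section \<open>The relation between S(1), D and a\<close>

text \<open>Multiplying by D removes \<open>Z\<close> through Z D = 2, with no division by
  D.\<close>

lemma pcong_jacobsthal_delannoy: "pcong 2 (of_int (jacobsthal 1) * delannoy) (- (delannoy\<^sup>2) - of_nat p)"
proof -
  have "pcong 2 (delannoy * of_int (jacobsthal 1)) (delannoy * (- delannoy - of_nat p * (Z / 2)))"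
    by (rule pcong_lmult[OF integral_delannoy pcong_jacobsthal_1])
  also have "delannoy * (- delannoy - of_nat p * (Z / 2)) = - (delannoy\<^sup>2) - of_nat p * (Z * delannoy / of_nat 2)"
    by (simp add: algebra_simps power2_eq_square)
  also have "pcong 2 \<dots> (- (delannoy\<^sup>2) - of_nat p * (2 / of_nat 2))"
    using p_gt_2 by (intro pcong_diff pcong_refl pcong_p_mult pcong_divide_nat pcong_Z_delannoy not_dvd_less) auto
  finally show ?thesis by (simp add: mult.commute)
qed

text \<open>Uniqueness of p = a^2 + b^2 gives S(1)/2 up to sign; its residue 2m - 1 modulo 4 and a =
  1 modulo 4 decide the sign.\<close>

lemma jacobsthal_1_eq:
  assumes "int p = a\<^sup>2 + b\<^sup>2" "a mod 4 = 1"
  shows "jacobsthal 1 = - 2 * (-1) ^ m * a"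
proof -
  obtain \<nu> where \<nu>: "\<phi> \<nu> = -1" by (rule exists_nonresidue)
  have sq: "jacobsthal 1 ^ 2 + jacobsthal \<nu> ^ 2 = 4 * int p"
    by (rule jacobsthal_sum_of_squares[OF \<nu>])
  obtain k where k: "jacobsthal 1 - (4 * int m - 2) = 8 * k"
    using jacobsthal_1_mod_8 by (auto simp: cong_iff_dvd_diff)
  define A where "A = 2 * int m - 1 + 4 * k"
  have A: "jacobsthal 1 = 2 * A" using k by (simp add: A_def)
  \<comment> \<open>Parity of S(\<open>\<nu>\<close>) is read off the two-square identity, so that
    division by 4 yields a representation of p itself.\<close>
  have "jacobsthal \<nu> ^ 2 = 2 * (2 * int p - 2 * A\<^sup>2)"
    using sq unfolding A by (simp add: power_mult_distrib)
  hence "even (jacobsthal \<nu> ^ 2)" by simp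
  hence "even (jacobsthal \<nu>)" by simp
  then obtain B where B: "jacobsthal \<nu> = 2 * B" by auto
  have AB: "int p = A\<^sup>2 + B\<^sup>2" using sq unfolding A B by (simp add: power2_eq_square)
  have "A\<^sup>2 = a\<^sup>2"
  proof (rule sum_two_squares_unique[OF prime_int_p AB assms(1)])
    show "odd (int p)" using odd_p by simp
    show "odd A" by (simp add: A_def)
    show "odd a" using assms(2) by presburger
  qed
  hence "A = a \<or> A = - a" by (simp add: power2_eq_iff)
  moreover have "A mod 4 = (if even m then 3 else 1)" unfolding A_def by presburger
  ultimately have "A = (if even m then - a else a)" using assms(2) by presburger
  hence "A = - ((-1) ^ m) * a" by (simp split: if_splits)
  thus ?thesis using A by simp
qed

end

theorem theorem2p10:
  fixes p :: nat and a b :: int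
  assumes "prime p" and "p mod 4 = 1"
    and "int p = a^2 + b^2" and "a mod 4 = 1"
  shows "rat_cong
     (\<Sum>k=0..(p - 1) div 4. of_nat ((4*k) choose (2*k))^2 / 16^(2*k))
     (1/2 + (-1)^((p - 1) div 4) * of_int a
          - (-1)^((p - 1) div 4) * of_nat p / (4 * of_int a))
     (int p ^ 2)"
proof -
  define m where "m = (p - 1) div 4"
  interpret prime_1_mod_4 p m
    by unfold_locales (use assms(1,2) in \<open>simp_all add: m_def\<close>, presburger)
  define s where "s = (-1 :: rat) ^ m"
  have s: "s * s = 1" by (simp add: s_def flip: power_add)
  \<comment> \<open>This is -S(1), the value of D to leading order.\<close>
  define T where "T = 2 * s * of_int a"
  have "rat_of_int (jacobsthal 1) = - T"
    using jacobsthal_1_eq[OF assms(3,4)] by (simp add: T_def s_def)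
  hence quad: "pcong 2 (- T * delannoy) (- (delannoy\<^sup>2) - of_nat p)" using pcong_jacobsthal_delannoy by simp
  have a0: "a \<noteq> 0" using assms(4) by auto
  \<comment> \<open>If p divided a it would divide b too, and then p^2 would divide p.\<close>
  have nda: "\<not> int p dvd a"
  proof
    assume "int p dvd a"
    moreover have "b\<^sup>2 = int p - a * a" using assms(3) by (simp add: power2_eq_square)
    hence "int p dvd b\<^sup>2" using \<open>int p dvd a\<close> by (simp only:) (intro dvd_diff dvd_refl dvd_mult)
    hence "int p dvd b" using prime_int_p prime_dvd_power by blast
    ultimately have "int p ^ 2 dvd a\<^sup>2 + b\<^sup>2" by (intro dvd_add dvd_power_same)
    hence "int p ^ 2 dvd int p" using assms(3) by simp
    hence "int p ^ 2 \<le> int p" by (rule zdvd_imp_le) simp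
    thus False using p_gt_2 by (simp add: power2_eq_square)
  qed
  have nd2: "\<not> int p dvd 2" using p_gt_2 by (auto dest: zdvd_imp_le)
  have nd2a: "\<not> int p dvd 2 * a" using nda nd2 prime_int_p by (simp add: prime_dvd_mult_iff)
  have iT: "integral T" unfolding T_def s_def by (intro integral_mult integral_sign integral_of_int integral_numeral)
  have "pcong 2 (delannoy\<^sup>2 + - T * delannoy) (delannoy\<^sup>2 + (- (delannoy\<^sup>2) - of_nat p))" by (rule pcong_add[OF pcong_refl quad])
  hence DE: "pcong 2 (delannoy * (delannoy - T)) (- of_nat p)" by (simp add: power2_eq_square algebra_simps)
  have "pcong 1 (delannoy * (delannoy - T)) (- of_nat p)" by (rule pcong_weaken[OF DE]) simp
  also have "pcong 1 (- of_nat p) 0" by (simp add: pcong_def integral_minus)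
  \<comment> \<open>\<open>Z\<close>, which inverts D up to the factor 2, cancels D and gives D = T
    modulo p.\<close>
  finally have "pcong 1 (Z * (delannoy * (delannoy - T))) (Z * 0)" by (intro pcong_lmult integral_Z)
  moreover have "Z * (delannoy * (delannoy - T)) = (delannoy - T) * (Z * delannoy)" by simp
  ultimately have "pcong 1 ((delannoy - T) * (Z * delannoy)) 0" by simp
  moreover have "pcong 1 ((delannoy - T) * (Z * delannoy)) ((delannoy - T) * 2)"
    by (intro pcong_lmult integral_diff integral_delannoy iT pcong_Z_delannoy)
  ultimately have "pcong 1 ((delannoy - T) * 2) 0" by (metis pcong_sym pcong_trans)
  hence "pcong 1 (of_int 2 * (delannoy - T)) (of_int 2 * 0)" by (simp add: mult.commute)
  from pcong_cancel[OF this nd2] have "integral ((delannoy - T) / of_nat p)" by (simp add: pcong_def)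
  hence "integral (((delannoy - T) / of_nat p) ^ 2)" by (rule integral_power)
  hence E2: "pcong 2 ((delannoy - T) ^ 2) 0" by (simp add: pcong_def power_divide)
  \<comment> \<open>D(D - T) - (D - T)^2 = T(D - T), and the square vanishes modulo p^2, so the
    quadratic relation becomes linear in D - T. The factor s turns T into the integer 2a, which is
    then cancelled.\<close>
  have "pcong 2 (s * (delannoy * (delannoy - T) - (delannoy - T) ^ 2)) (s * (- of_nat p - 0))"
    unfolding s_def by (intro pcong_lmult integral_sign pcong_diff DE[unfolded s_def] E2)
  moreover have "s * (delannoy * (delannoy - T) - (delannoy - T) ^ 2) = (s * s) * (of_int (2 * a) * (delannoy - T))"
    by (simp add: T_def power2_eq_square algebra_simps)
  moreover have "s * (- of_nat p - 0) = of_int (2 * a) * (- s * of_nat p / of_int (2 * a))"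
    using a0 by simp
  ultimately have "pcong 2 (of_int (2 * a) * (delannoy - T)) (of_int (2 * a) * (- s * of_nat p / of_int (2 * a)))"
    unfolding s by simp
  from pcong_cancel[OF this nd2a] have "pcong 2 (delannoy - T) (- s * of_nat p / of_int (2 * a))" .
  from pcong_add[OF pcong_refl[of 2 "1 + T"] this]
  have "pcong 2 ((1 + delannoy) / of_int 2) ((1 + T + - s * of_nat p / of_int (2 * a)) / of_int 2)"
    using nd2 by (intro pcong_divide) (simp_all add: algebra_simps)
  also have "(1 + T + - s * of_nat p / of_int (2 * a)) / of_int 2 = 1 / 2 + s * of_int a - s * of_nat p / (4 * of_int a)"
    using a0 by (simp add: T_def field_simps)
  finally have "pcong 2 (\<Sum>k=0..m. of_nat ((4 * k) choose (2 * k)) ^ 2 / 16 ^ (2 * k)) (1 / 2 + s * of_int a - s * of_nat p / (4 * of_int a))"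
    using pcong_trans[OF pcong_even_central_binomial_sum] by simp
  thus ?thesis unfolding s_def m_def[symmetric] by (intro pcong_imp_rat_cong) simp_all
qed
end
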